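(* Let $\psi:\mathbb{N}\rightarrow[0,1)$ be any function. If there exists an $\epsilon>0$ such that $$\sum_{n\in\mathbb{N}}\psi(n)^{1+\epsilon}\cdot\frac{\varphi(n)}{n}=\infty,$$ then $\mathcal{M}(W(\psi))=1$.
   Context: $\mathbb{N}$ denotes the positive integers, $\varphi$ is Euler's totient function, and $\mathcal{M}$ is the Lebesgue measure on $\mathbb{R}$. For a function $\psi:\mathbb{N}\rightarrow[0,\infty)$, $W(\psi)$ denotes the set of $x\in[0,1]$ for which $|xn-m|<\psi(n)$ holds for infinitely many pairs $(n,m)\in\mathbb{N}\times\mathbb{Z}$ with $n$ and $m$ coprime. *)

theory Defs
  imports "HOL-Analysis.Analysis" "HOL-Number_Theory.Totient"
begin

text \<open>
  The positive integers are the naturals \<open>n \<ge> 1\<close>; the value \<open>\<psi> 0\<close> plays no role.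
\<close>

definition W :: "(nat \<Rightarrow> real) \<Rightarrow> real set" where
  "W \<psi> = {x \<in> {0..1}. infinite {(n :: nat, m :: int).
             n \<ge> 1 \<and> coprime (int n) m \<and> \<bar>x * real n - real_of_int m\<bar> < \<psi> n}}"

end

theory Submission
  imports Defs
begin

text \<open>
  Splitting the values of \<open>\<psi>\<close> dyadically, the divergence with the extra power \<open>\<epsilon>\<close> yields, beyond every
  bound, a finite set \<open>S\<close> and a \<open>\<delta>\<close> with \<open>\<psi> \<ge> \<delta>\<close> on \<open>S\<close> and \<open>M = (\<Sum>n\<in>S. totient n / n) \<ge> \<delta> powr - (1 + \<epsilon>/2)\<close>. For
  such a set the approximation sets \<open>A n\<close> are quasi-independent on average. Indeed \<open>A m\<close> and \<open>A n\<close> are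
  quasi-independent, by a sieve estimate, unless \<open>m/n\<close> is a fraction of height at most about
  \<open>\<delta> powr - 1\<close>. The exceptional pairs are rare because of the divisor bound and iterated
  Cauchy--Schwarz, in the spirit of bounds for GCD sums: their weight is \<open>M powr (1 + o(1)) / \<delta>\<close>,
  which is smaller than \<open>M\<^sup>2\<close> by a power of \<open>\<delta>\<close>.

  No zero-one law is needed. If the complement of \<open>W \<psi>\<close> had positive measure, it would contain
  a compact \<open>K\<close> of positive measure. The functions \<open>(\<Sum>n\<in>S. indicator (A n)) / (\<delta> * M)\<close> are bounded in \<open>L\<^sup>2\<close> and
  equidistributed on intervals, hence also have mass bounded below on \<open>K\<close>, so by Cauchy--Schwarz
  the union of the \<open>A n\<close> meets \<open>K\<close> in measure bounded below, and so does \<open>W \<psi>\<close>.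
\<close>

subsection \<open>The divisor function and the totient ratio\<close>

text \<open>For \<open>m \<noteq> n\<close> let \<open>a / b\<close> be \<open>m / n\<close> in
  lowest terms and \<open>D = \<delta> * max a b\<close>. The overlap of the two sets is at most
  \<open>4 * \<delta>\<^sup>2 * totient_ratio m * totient_ratio n\<close> times a correction factor:
  the sum of \<open>1 / totient_ratio c\<close> over \<open>c \<le> 2 * D\<close> coprime to
  \<open>a * b\<close>, divided by \<open>D * totient_ratio (a * b)\<close>. The sieve bounds this
  factor when \<open>a * b\<close> is at most a fixed power of \<open>D\<close>. As
  \<open>a * b\<close> can be as large as \<open>(D / \<delta>)\<^sup>2\<close>, this asks for
  \<open>D \<ge> \<delta> powr - \<theta>\<close>, so the height threshold has to be
  \<open>\<delta> powr - (1 + \<theta>)\<close> rather than \<open>1 / \<delta>\<close>; part of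
  \<epsilon> is spent here, and the rest pays for the divisor bounds.

  All sets of one level share the radius \<delta>. Therefore \<open>D\<close> depends on the ratio
  \<open>m / n\<close> alone, and the exceptional pairs are linked by multiplication with a fraction
  from one fixed set, which makes them accessible to an operator power argument. Nothing bounds
  \<open>\<delta> * M\<close> from above; every estimate is normalised by it, and the final
  Cauchy--Schwarz step carries a free scale for this reason.\<close>

definition totient_ratio :: "nat \<Rightarrow> real" where
  "totient_ratio n = real (totient n) / real n"

lemma totient_ratio_prod: "n > 0 \<Longrightarrow> totient_ratio n = (\<Prod>p\<in>prime_factors n. 1 - 1 / real p)"
  unfolding totient_ratio_def using totient_formula2[of n] by simp

lemma totient_ratio_pos: "n > 0 \<Longrightarrow> totient_ratio n > 0"
  by (simp add: totient_ratio_def)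

lemma totient_ratio_le_1: "totient_ratio n \<le> 1"
  by (cases "n = 0") (auto simp: totient_ratio_def totient_le)

lemma card_divisors_mult_le:
  fixes m n :: nat
  assumes "m > 0" "n > 0"
  shows "card {d. d dvd m * n} \<le> card {d. d dvd m} * card {d. d dvd n}"
proof -
  have "{d. d dvd m * n} \<subseteq> (\<lambda>(a, b). a * b) ` ({d. d dvd m} \<times> {d. d dvd n})"
    by (auto dest!: division_decomp)
  then have "card {d. d dvd m * n} \<le> card ({d. d dvd m} \<times> {d. d dvd n})"
    using assms by (intro surj_card_le) auto
  then show ?thesis by (simp add: card_cartesian_product)
qed

lemma card_divisors_prime_power:
  assumes "prime (p::nat)"
  shows "card {d. d dvd p ^ a} = a + 1"
proof -
  have "{d. d dvd p ^ a} = (\<lambda>i. p ^ i) ` {..a}"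
    using assms by (auto simp: divides_primepow_nat le_imp_power_dvd)
  moreover have "inj_on (\<lambda>i. p ^ i) {..a}"
    using assms prime_gt_1_nat by (intro inj_onI) (auto dest: power_inject_exp[THEN iffD1, rotated])
  ultimately show ?thesis by (simp add: card_image)
qed

text \<open>The divisor bound. On a prime power,
  \<open>a + 1 \<le> 2 ^ a \<le> (p ^ a) powr \<eta>\<close> as soon as
  \<open>p powr \<eta> \<ge> 2\<close>. Each of the fewer than \<open>T\<close> smaller primes costs
  at most a factor \<open>K\<close>, which gives the constant \<open>K ^ T\<close>.\<close>

lemma card_divisors_le_powr:
  fixes \<eta> :: real
  assumes "\<eta> > 0"
  obtains C where "C \<ge> 1" "\<And>n::nat. n > 0 \<Longrightarrow> real (card {d. d dvd n}) \<le> C * real n powr \<eta>"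
proof -
  \<comment> \<open>\<open>K * \<eta> * ln 2 \<ge> 1\<close> makes \<open>a + 1\<close> at most
    \<open>K * (1 + a * \<eta> * ln 2)\<close>, hence at most
    \<open>K * (2 ^ a) powr \<eta>\<close>.\<close>
  define K where "K = max 1 (1 / (\<eta> * ln 2))"
  define T where "T = nat \<lceil>2 powr (1 / \<eta>)\<rceil>"
  have K1: "K \<ge> 1" by (simp add: K_def)
  have pp: "real a + 1 \<le> (if p < T then K else 1) * real (p ^ a) powr \<eta>" if "prime p" for p a :: nat
  proof (cases "p < T")
    case True
    have "real a + 1 \<le> K * (1 + real a * \<eta> * ln 2)"
    proof -
      have "K * (\<eta> * ln 2) \<ge> 1"
        using assms by (simp add: K_def max_def field_simps)
      then have "real a \<le> K * (real a * \<eta> * ln 2)"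
        using mult_left_mono[of 1 "K * (\<eta> * ln 2)" "real a"] by (simp add: mult_ac)
      then show ?thesis using K1 by (simp add: distrib_left)
    qed
    also have "1 + real a * \<eta> * ln 2 \<le> exp (real a * \<eta> * ln 2)"
      by (rule exp_ge_add_one_self)
    also have "exp (real a * \<eta> * ln 2) = (2 ^ a) powr \<eta>"
      by (simp add: powr_def ln_realpow mult_ac)
    also have "(2 ^ a) powr \<eta> \<le> real (p ^ a) powr \<eta>"
      using assms prime_ge_2_nat[OF that] by (intro powr_mono2) (auto intro!: power_mono)
    finally show ?thesis using K1 True by simp
  next
    case False
    then have "2 powr (1 / \<eta>) \<le> real p" unfolding T_def by linarith
    then have "(2 powr (1 / \<eta>)) powr \<eta> \<le> real p powr \<eta>"
      using assms by (intro powr_mono2) auto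
    then have 2: "2 \<le> real p powr \<eta>" using assms by (simp add: powr_powr)
    have "real a + 1 \<le> 2 ^ a"
      by (induction a) auto
    also have "\<dots> \<le> (real p powr \<eta>) ^ a" using 2 by (intro power_mono) auto
    also have "\<dots> = real (p ^ a) powr \<eta>"
      using prime_gt_0_nat[OF that] by (simp add: powr_power powr_realpow[symmetric] powr_powr mult.commute)
    finally show ?thesis using False by simp
  qed
  have main: "real (card {d. d dvd n}) \<le> K ^ card {p \<in> prime_factors n. p < T} * real n powr \<eta>" if "n > 0" for n :: nat
    using that
  proof (induction n rule: less_induct)
    case (less n)
    show ?case
    proof (cases "n = 1")
      case False
      then obtain p where p: "prime p" "p dvd n" using prime_factor_nat by blast
      obtain m where m: "n = p ^ multiplicity p n * m" "\<not> p dvd m"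
        using p less.prems by (metis multiplicity_decompose' not_prime_unit gr_implies_not0)
      define a where "a = multiplicity p n"
      have a: "a > 0" using p less.prems by (simp add: a_def prime_multiplicity_gt_zero_iff)
      have nm: "n = p ^ a * m" using m by (simp add: a_def)
      have m0: "m > 0" using less.prems nm by (auto intro!: Nat.gr0I)
      have "p ^ a > 1" using a p prime_gt_1_nat one_less_power by blast
      then have mn: "m < n" using nm m0 by simp
      have pf: "prime_factors n = insert p (prime_factors m)"
        using nm m0 a p by (simp add: prime_factors_product prime_factorization_prime_power)
      have cardeq: "card {q \<in> prime_factors n. q < T} = (if p < T then 1 else 0) + card {q \<in> prime_factors m. q < T}"
      proof -
        have fin: "finite {q \<in> prime_factors m. q < T}"
          by (rule finite_subset[of _ "prime_factors m"]) auto
        have notin: "p \<notin> {q \<in> prime_factors m. q < T}" using m by auto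
        have eq: "{q \<in> prime_factors n. q < T} = (if p < T then insert p {q \<in> prime_factors m. q < T} else {q \<in> prime_factors m. q < T})"
          using pf by auto
        show ?thesis unfolding eq using card_insert_disjoint[OF fin notin] by presburger
      qed
      have "real (card {d. d dvd n}) \<le> real (card {d. d dvd p ^ a}) * real (card {d. d dvd m})"
        using card_divisors_mult_le[of "p ^ a" m] nm m0 p by (simp add: prime_gt_0_nat flip: of_nat_mult)
      also have "\<dots> \<le> ((if p < T then K else 1) * real (p ^ a) powr \<eta>) * (K ^ card {p \<in> prime_factors m. p < T} * real m powr \<eta>)"
        using pp[OF p(1), of a] less.IH[OF mn m0] K1 by (intro mult_mono) (auto simp: card_divisors_prime_power[OF p(1)])
      also have "\<dots> = K ^ card {p \<in> prime_factors n. p < T} * real n powr \<eta>"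
      proof -
        have "real n powr \<eta> = real (p ^ a) powr \<eta> * real m powr \<eta>"
          using nm by (simp add: powr_mult)
        then show ?thesis unfolding cardeq by simp
      qed
      finally show ?thesis .
    qed auto
  qed
  show thesis
  proof (rule that[of "K ^ T"])
    show "K ^ T \<ge> 1" using K1 by simp
    fix n :: nat assume n: "n > 0"
    have "card {p \<in> prime_factors n. p < T} \<le> card {..<T}" by (intro card_mono) auto
    then have "K ^ card {p \<in> prime_factors n. p < T} \<le> K ^ T" using K1 by (intro power_increasing) auto
    then show "real (card {d. d dvd n}) \<le> K ^ T * real n powr \<eta>"
      by (intro order_trans[OF main[OF n]] mult_right_mono) simp_all
  qed
qed

lemma prod_prime_factors_dvd:
  assumes "n > (0::nat)"
  shows "\<Prod>(prime_factors n) dvd n"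
proof -
  have "\<Prod>(prime_factors n) dvd (\<Prod>p\<in>prime_factors n. p ^ multiplicity p n)"
    by (intro prod_dvd_prod) (auto simp: prime_factors_multiplicity intro!: dvd_power)
  also have "\<dots> = n" using assms by (simp add: prime_factorization_nat[symmetric])
  finally show ?thesis .
qed

text \<open>Distinct subsets of the prime factors have distinct products, and these are the
  squarefree divisors.\<close>

lemma two_power_card_prime_factors_le:
  assumes "n > (0::nat)"
  shows "2 ^ card (prime_factors n) \<le> card {d. d dvd n}"
proof -
  have "inj_on (\<lambda>A. \<Prod>A) (Pow (prime_factors n))"
  proof (rule inj_onI)
    fix A B assume A: "A \<in> Pow (prime_factors n)" and B: "B \<in> Pow (prime_factors n)" and eq: "\<Prod>A = \<Prod>B"
    have *: "prime_factors (\<Prod>A) = A" if "A \<in> Pow (prime_factors n)" for A :: "nat set"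
    proof -
      have fA: "finite A" using that finite_subset by auto
      have pA: "\<And>p. p \<in> A \<Longrightarrow> prime p" using that by auto
      then have "prime_factors (\<Prod>A) = (\<Union>p\<in>A. prime_factors p)"
        using fA by (subst prime_factors_prod) (auto dest: prime_gt_0_nat)
      also have "\<dots> = A" using pA by (auto simp: prime_factorization_prime)
      finally show ?thesis .
    qed
    show "A = B" using *[OF A] *[OF B] unfolding eq by (rule trans[OF sym])
  qed
  note card_image[OF this]
  also have "card (Pow (prime_factors n)) = 2 ^ card (prime_factors n)"
    by (rule card_Pow) simp
  finally have card_eq: "card ((\<lambda>A. \<Prod>A) ` Pow (prime_factors n)) = 2 ^ card (prime_factors n)" .
  have sub: "(\<lambda>A. \<Prod>A) ` Pow (prime_factors n) \<subseteq> {d. d dvd n}"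
  proof safe
    fix A assume A: "A \<subseteq> prime_factors n"
    have "\<Prod>A dvd \<Prod>(prime_factors n)" using A by (intro prod_dvd_prod_subset) auto
    also have "\<dots> dvd n" using assms by (rule prod_prime_factors_dvd)
    finally show "\<Prod>A dvd n" .
  qed
  show ?thesis
    using card_mono[OF finite_divisors_nat[OF assms] sub] unfolding card_eq .
qed

text \<open>Each factor \<open>p / (p - 1)\<close> is at most 2. With the divisor bound this shows
  that \<open>1 / totient_ratio n\<close> grows more slowly than any power of
  \<open>n\<close>.\<close>

lemma inverse_totient_ratio_le_card_divisors:
  assumes "n > (0::nat)"
  shows "1 / totient_ratio n \<le> real (card {d. d dvd n})"
proof -
  have "1 / totient_ratio n = (\<Prod>p\<in>prime_factors n. 1 / (1 - 1 / real p))"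
    using assms by (simp add: totient_ratio_prod prod_dividef)
  also have "\<dots> \<le> (\<Prod>p\<in>prime_factors n. 2)"
  proof (rule prod_mono)
    fix p assume "p \<in> prime_factors n"
    then have "real p \<ge> 2" using prime_ge_2_nat by auto
    then show "0 \<le> 1 / (1 - 1 / real p) \<and> 1 / (1 - 1 / real p) \<le> 2" by (auto simp: field_simps)
  qed
  also have "\<dots> = real (2 ^ card (prime_factors n))" by simp
  also have "\<dots> \<le> real (card {d. d dvd n})"
    using two_power_card_prime_factors_le[OF assms] of_nat_le_iff by blast
  finally show ?thesis .
qed

subsection \<open>Pairs of integers with a ratio of small height\<close>

definition tuples :: "nat \<Rightarrow> nat \<Rightarrow> nat list set" where
  "tuples X k = {as. set as \<subseteq> {1..X} \<and> length as = k}"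

text \<open>Let \<mu> be the measure on the positive rationals with one unit of mass at
  \<open>a / b\<close> for every pair \<open>1 \<le> a, b \<le> X\<close>. This is the quadratic
  form of the \<open>k\<close>-fold multiplicative convolution power of \<mu>, evaluated at
  \<open>v\<close> supported on \<open>S\<close>; keeping tuples instead of products records the
  multiplicities.\<close>

definition energy :: "nat \<Rightarrow> nat \<Rightarrow> nat set \<Rightarrow> (nat \<Rightarrow> real) \<Rightarrow> real" where
  "energy X k S v = (\<Sum>i\<in>tuples X k \<times> tuples X k. \<Sum>x\<in>S. \<Sum>z\<in>S.
     if prod_list (fst i) * x = prod_list (snd i) * z then v x * v z else 0)"

lemma finite_tuples: "finite (tuples X k)"
  unfolding tuples_def by (rule finite_lists_length_eq) simp

lemma card_tuples: "card (tuples X k) = X ^ k"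
  unfolding tuples_def by (subst card_lists_length_eq) simp_all

lemma prod_list_tuples:
  assumes "as \<in> tuples X k"
  shows "prod_list as > 0" "prod_list as \<le> X ^ k"
proof -
  have "set as \<subseteq> {1..X} \<Longrightarrow> prod_list as > 0 \<and> prod_list as \<le> X ^ length as" for as
    by (induction as) (auto intro!: mult_mono)
  then show "prod_list as > 0" "prod_list as \<le> X ^ k"
    using assms by (auto simp: tuples_def)
qed

lemma energy_nonneg: "(\<And>x. x \<in> S \<Longrightarrow> v x \<ge> 0) \<Longrightarrow> energy X k S v \<ge> 0"
  unfolding energy_def by (intro sum_nonneg) auto

text \<open>Cauchy--Schwarz for a symmetric operator: the square of \<open><v, T v>\<close> is at
  most \<open>|v|^2 * |T v|^2\<close>, and \<open>|T v|^2\<close> is \<open><v, T^2 v>\<close>. The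
  norm of \<open>T v\<close> is taken over \<open>S\<close> only, which can only decrease
  it.\<close>

lemma energy_square_le:
  assumes S: "finite S" and v: "\<And>x. x \<in> S \<Longrightarrow> v x \<ge> 0"
  shows "(energy X k S v)\<^sup>2 \<le> (\<Sum>x\<in>S. (v x)\<^sup>2) * energy X (2 * k) S v"
proof -
  define T where "T = tuples X k"
  define I where "I = T \<times> T"
  define \<alpha> :: "nat list \<times> nat list \<Rightarrow> nat" where "\<alpha> = (\<lambda>i. prod_list (fst i))"
  define \<beta> :: "nat list \<times> nat list \<Rightarrow> nat" where "\<beta> = (\<lambda>i. prod_list (snd i))"
  define h where "h = (\<lambda>p x. if \<alpha> (fst p) * x = \<beta> (fst p) * snd p then v (snd p) else 0)"
  define g where "g = (\<lambda>x. \<Sum>p\<in>I \<times> S. h p x)"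
  define K where "K = (\<lambda>i j z w. if \<beta> i * \<alpha> j * z = \<beta> j * \<alpha> i * w then v z * v w else 0)"
  have finI: "finite I" by (simp add: I_def T_def finite_tuples)
  have pos: "\<alpha> i > 0" if "i \<in> I" for i
    using that prod_list_tuples(1) by (auto simp: I_def T_def \<alpha>_def)
  have "energy X k S v = (\<Sum>i\<in>I. \<Sum>x\<in>S. v x * (\<Sum>z\<in>S. h (i, z) x))"
    unfolding energy_def I_def[symmetric] T_def[symmetric] sum_distrib_left h_def \<alpha>_def \<beta>_def
    by (intro sum.cong refl) auto
  also have "\<dots> = (\<Sum>x\<in>S. \<Sum>i\<in>I. v x * (\<Sum>z\<in>S. h (i, z) x))"
    by (rule sum.swap)
  also have "\<dots> = (\<Sum>x\<in>S. v x * g x)"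
    unfolding g_def sum_distrib_left sum.cartesian_product by (simp add: case_prod_beta)
  finally have "(energy X k S v)\<^sup>2 \<le> (\<Sum>x\<in>S. (v x)\<^sup>2) * (\<Sum>x\<in>S. (g x)\<^sup>2)"
    using Cauchy_Schwarz_ineq_sum[of v g S] by simp
  also have "(\<Sum>x\<in>S. (g x)\<^sup>2) \<le> energy X (2 * k) S v"
  proof -
    have "(\<Sum>x\<in>S. (g x)\<^sup>2) = (\<Sum>x\<in>S. \<Sum>p\<in>I \<times> S. \<Sum>q\<in>I \<times> S. h p x * h q x)"
      by (simp only: g_def power2_eq_square sum_product)
    also have "\<dots> = (\<Sum>p\<in>I \<times> S. \<Sum>x\<in>S. \<Sum>q\<in>I \<times> S. h p x * h q x)"
      by (rule sum.swap)
    also have "\<dots> = (\<Sum>p\<in>I \<times> S. \<Sum>q\<in>I \<times> S. \<Sum>x\<in>S. h p x * h q x)"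
      by (intro sum.cong refl sum.swap)
    also have "\<dots> \<le> (\<Sum>p\<in>I \<times> S. \<Sum>q\<in>I \<times> S. K (fst p) (fst q) (snd p) (snd q))"
    proof (intro sum_mono)
      fix p q assume p: "p \<in> I \<times> S" and q: "q \<in> I \<times> S"
      obtain i z where pz: "p = (i, z)" by (cases p)
      obtain j w where qw: "q = (j, w)" by (cases q)
      have iI: "i \<in> I" "z \<in> S" "j \<in> I" "w \<in> S" using p q pz qw by auto
      have nn: "0 \<le> v z * v w" using v iI by simp
      show "(\<Sum>x\<in>S. h p x * h q x) \<le> K (fst p) (fst q) (snd p) (snd q)"
      \<comment> \<open>The relation with \<open>i\<close> and \<open>z\<close> determines
        \<open>x\<close>, so at most one term survives, and eliminating \<open>x\<close> from both
        relations leaves the condition in \<open>K\<close>.\<close>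
      proof (cases "\<exists>x\<in>S. \<alpha> i * x = \<beta> i * z \<and> \<alpha> j * x = \<beta> j * w")
        case True
        then obtain x0 where x0: "x0 \<in> S" "\<alpha> i * x0 = \<beta> i * z" "\<alpha> j * x0 = \<beta> j * w" by blast
        have "(\<beta> i * z) * \<alpha> j = (\<beta> j * w) * \<alpha> i"
          unfolding x0(2)[symmetric] x0(3)[symmetric] by (simp add: mult_ac)
        then have Keq: "K i j z w = v z * v w" by (simp add: K_def mult_ac)
        have "(\<Sum>x\<in>S. h p x * h q x) \<le> (\<Sum>x\<in>S. if x = x0 then v z * v w else 0)"
        proof (intro sum_mono)
          fix x assume "x \<in> S"
          have "x = x0" if "\<alpha> i * x = \<beta> i * z"
            using that x0(2) pos[OF iI(1)] by (metis mult_cancel1 not_gr0)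
          then show "h p x * h q x \<le> (if x = x0 then v z * v w else 0)"
            using nn by (auto simp: h_def pz qw)
        qed
        also have "\<dots> = v z * v w" using S x0(1) by (simp add: sum.delta')
        finally show ?thesis using Keq by (simp add: pz qw)
      next
        case False
        then have "(\<Sum>x\<in>S. h p x * h q x) = 0"
          by (intro sum.neutral) (auto simp: h_def pz qw)
        then show ?thesis using nn by (auto simp: K_def pz qw)
      qed
    qed
    also have "\<dots> = (\<Sum>i\<in>I. \<Sum>z\<in>S. \<Sum>j\<in>I. \<Sum>w\<in>S. K i j z w)"
    proof -
      have prs: "(\<Sum>p\<in>I \<times> S. F (fst p) (snd p)) = (\<Sum>i\<in>I. \<Sum>z\<in>S. F i z)" for F :: "_ \<Rightarrow> _ \<Rightarrow> real"
        by (simp add: sum.cartesian_product case_prod_beta)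
      show ?thesis
        unfolding prs[of "\<lambda>i z. \<Sum>q\<in>I \<times> S. K i (fst q) z (snd q)"]
        by (intro sum.cong refl prs)
    qed
    also have "\<dots> = (\<Sum>i\<in>I. \<Sum>j\<in>I. \<Sum>z\<in>S. \<Sum>w\<in>S. K i j z w)"
      by (intro sum.cong refl sum.swap)
    also have "\<dots> = (\<Sum>r\<in>I \<times> I. \<Sum>z\<in>S. \<Sum>w\<in>S. K (fst r) (snd r) z w)"
      by (subst sum.cartesian_product) (simp add: case_prod_beta)
    also have "\<dots> \<le> energy X (2 * k) S v"
    proof -
      \<comment> \<open>Concatenation turns the condition in \<open>K\<close> into the relation for
        tuples of length \<open>2 * k\<close>; it is injective since all parts have length
        \<open>k\<close>.\<close>
      define \<Phi> :: "(nat list \<times> nat list) \<times> (nat list \<times> nat list) \<Rightarrow> nat list \<times> nat list"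
        where "\<Phi> = (\<lambda>r. (snd (fst r) @ fst (snd r), snd (snd r) @ fst (fst r)))"
      define G where "G = (\<lambda>i. \<Sum>x\<in>S. \<Sum>z\<in>S.
         if prod_list (fst i) * x = prod_list (snd i) * z then v x * v z else 0)"
      have len: "length (fst i) = k" "length (snd i) = k" if "i \<in> I" for i
        using that by (auto simp: I_def T_def tuples_def)
      have inj: "inj_on \<Phi> (I \<times> I)"
      proof (rule inj_onI)
        fix r r' assume r: "r \<in> I \<times> I" "r' \<in> I \<times> I" and eq: "\<Phi> r = \<Phi> r'"
        have mem: "fst r \<in> I" "snd r \<in> I" "fst r' \<in> I" "snd r' \<in> I" using r by auto
        have "snd (fst r) = snd (fst r') \<and> fst (snd r) = fst (snd r')"
          using eq by (subst append_eq_append_conv[symmetric]) (simp_all add: \<Phi>_def len mem)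
        moreover have "snd (snd r) = snd (snd r') \<and> fst (fst r) = fst (fst r')"
          using eq by (subst append_eq_append_conv[symmetric]) (simp_all add: \<Phi>_def len mem)
        ultimately show "r = r'" by (simp add: prod_eq_iff)
      qed
      have "(\<Sum>r\<in>I \<times> I. \<Sum>z\<in>S. \<Sum>w\<in>S. K (fst r) (snd r) z w) = (\<Sum>r\<in>I \<times> I. G (\<Phi> r))"
        by (simp add: K_def G_def \<Phi>_def \<alpha>_def \<beta>_def)
      also have "\<dots> = sum G (\<Phi> ` (I \<times> I))"
        using sum.reindex[OF inj, of G] by simp
      also have "\<dots> \<le> sum G (tuples X (2 * k) \<times> tuples X (2 * k))"
      proof (rule sum_mono2)
        show "finite (tuples X (2 * k) \<times> tuples X (2 * k))" by (simp add: finite_tuples)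
        show "\<Phi> ` (I \<times> I) \<subseteq> tuples X (2 * k) \<times> tuples X (2 * k)"
          by (clarsimp simp: \<Phi>_def I_def T_def tuples_def)
        show "0 \<le> G b" for b
          unfolding G_def using v by (intro sum_nonneg) auto
      qed
      finally show ?thesis unfolding energy_def G_def by simp
    qed
    finally show ?thesis .
  qed
  finally show ?thesis by (simp add: mult_left_mono sum_nonneg)
qed

text \<open>The gain lies in the root: at order \<open>2 ^ s\<close> even the trivial bound by the
  square of \<open>\<Sum>x\<in>S. v x\<close> is harmless, because only its \<open>2 ^ s\<close>-th
  root enters the estimate at order 1.\<close>

lemma energy_power_le:
  assumes S: "finite S" and v: "\<And>x. x \<in> S \<Longrightarrow> v x \<ge> 0"
  shows "energy X 1 S v ^ (2 ^ s) \<le> (\<Sum>x\<in>S. (v x)\<^sup>2) ^ (2 ^ s - 1) * energy X (2 ^ s) S v"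
proof (induction s)
  case (Suc s)
  define V where "V = (\<Sum>x\<in>S. (v x)\<^sup>2)"
  have V: "V \<ge> 0" by (simp add: V_def sum_nonneg)
  have E: "energy X j S v \<ge> 0" for j using v by (rule energy_nonneg)
  have "energy X 1 S v ^ (2 ^ Suc s) = (energy X 1 S v ^ (2 ^ s))\<^sup>2"
    by (simp add: power_mult[symmetric] mult.commute)
  also have "\<dots> \<le> (V ^ (2 ^ s - 1) * energy X (2 ^ s) S v)\<^sup>2"
    using Suc.IH E by (intro power_mono) (auto simp: V_def)
  also have "\<dots> = V ^ (2 * (2 ^ s - 1)) * (energy X (2 ^ s) S v)\<^sup>2"
    by (simp add: power_mult_distrib power_mult[symmetric] mult.commute)
  also have "\<dots> \<le> V ^ (2 * (2 ^ s - 1)) * (V * energy X (2 * 2 ^ s) S v)"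
    using energy_square_le[OF S v, where X = X and k = "2 ^ s"] V by (intro mult_left_mono) (auto simp: V_def)
  also have "\<dots> = V ^ (2 * (2 ^ s - 1) + 1) * energy X (2 ^ Suc s) S v" by simp
  also have "2 * (2 ^ s - 1) + 1 = 2 ^ Suc s - (1::nat)"
  proof -
    have "(2::nat) ^ s \<ge> 1" by simp
    then show ?thesis by (simp only: power_Suc)
  qed
  finally show ?case by (simp add: V_def)
qed simp

text \<open>If there is such a tuple, then the product is determined by \<open>N\<close> and
  \<open>x\<close> and is at most \<open>X ^ k\<close>; each of the \<open>k\<close> entries is one
  of its divisors.\<close>

lemma card_tuples_eq_le:
  assumes C: "\<And>n::nat. n > 0 \<Longrightarrow> real (card {d. d dvd n}) \<le> C * real n powr \<eta>"
    and \<eta>: "\<eta> \<ge> 0" and X: "X \<ge> 1" and C1: "C \<ge> 1" and x: "x > 0"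
  shows "real (card {as \<in> tuples X k. prod_list as * x = N}) \<le> (C * real (X ^ k) powr \<eta>) ^ k"
proof (cases "{as \<in> tuples X k. prod_list as * x = N} = {}")
  case True
  then show ?thesis using C1 by (simp only: True) simp
next
  case False
  then obtain bs where bs: "bs \<in> tuples X k" "prod_list bs * x = N" by auto
  define n where "n = prod_list bs"
  have n: "n > 0" "n \<le> X ^ k" using prod_list_tuples[OF bs(1)] by (auto simp: n_def)
  have eq: "prod_list as = n" if "prod_list as * x = N" for as
    using that bs(2) x by (auto simp: n_def)
  have sub: "{as \<in> tuples X k. prod_list as * x = N} \<subseteq> {as. set as \<subseteq> {d. d dvd n} \<and> length as = k}"
    using eq by (auto simp: tuples_def intro: prod_list_dvd)
  have "card {as \<in> tuples X k. prod_list as * x = N} \<le> card {d. d dvd n} ^ k"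
    using card_mono[OF finite_lists_length_eq sub] n by (simp add: card_lists_length_eq)
  then have "real (card {as \<in> tuples X k. prod_list as * x = N}) \<le> real (card {d. d dvd n}) ^ k"
    unfolding of_nat_power[symmetric] of_nat_le_iff .
  also have "\<dots> \<le> (C * real (X ^ k) powr \<eta>) ^ k"
  proof (rule power_mono)
    have "real (card {d. d dvd n}) \<le> C * real n powr \<eta>" using C n by simp
    also have "\<dots> \<le> C * real (X ^ k) powr \<eta>"
      using n C1 \<eta> by (intro mult_left_mono powr_mono2) (auto simp del: of_nat_power)
    finally show "real (card {d. d dvd n}) \<le> C * real (X ^ k) powr \<eta>" .
  qed simp
  finally show ?thesis .
qed

text \<open>For fixed \<open>x\<close> and \<open>z\<close> there are \<open>X ^ k\<close> choices
  of the second tuple, after which the first one has a prescribed product.\<close>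

lemma energy_le:
  assumes C: "\<And>n::nat. n > 0 \<Longrightarrow> real (card {d. d dvd n}) \<le> C * real n powr \<eta>"
    and \<eta>: "\<eta> \<ge> 0" and X: "X \<ge> 1" and C1: "C \<ge> 1"
    and S: "finite S" "0 \<notin> S" and v: "\<And>x. x \<in> S \<Longrightarrow> v x \<ge> 0"
  shows "energy X k S v \<le> (\<Sum>x\<in>S. v x)\<^sup>2 * (real X ^ k * (C * real (X ^ k) powr \<eta>) ^ k)"
proof -
  define T where "T = tuples X k"
  define B where "B = (C * real (X ^ k) powr \<eta>) ^ k"
  have fT: "finite T" by (simp add: T_def finite_tuples)
  have cnt: "(\<Sum>i\<in>T \<times> T. if prod_list (fst i) * x = prod_list (snd i) * z then 1 else 0) \<le> real X ^ k * B"
    if "x \<in> S" for x z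
  proof -
    have x: "x > 0" using that S by (auto intro: Nat.gr0I)
    have "(\<Sum>i\<in>T \<times> T. if prod_list (fst i) * x = prod_list (snd i) * z then 1 else 0)
      = (\<Sum>bs\<in>T. \<Sum>as\<in>T. if prod_list as * x = prod_list bs * z then 1 else (0::real))"
      by (subst sum.swap) (simp add: sum.cartesian_product case_prod_beta)
    also have "\<dots> = (\<Sum>bs\<in>T. real (card {as \<in> T. prod_list as * x = prod_list bs * z}))"
      using fT by (intro sum.cong refl) (simp add: sum.If_cases Int_def)
    also have "\<dots> \<le> (\<Sum>bs\<in>T. B)"
      unfolding T_def B_def by (intro sum_mono card_tuples_eq_le[OF C \<eta> X C1 x])
    also have "\<dots> = real X ^ k * B" by (simp add: T_def card_tuples)
    finally show ?thesis .
  qed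
  have "energy X k S v = (\<Sum>x\<in>S. \<Sum>i\<in>T \<times> T. \<Sum>z\<in>S.
     if prod_list (fst i) * x = prod_list (snd i) * z then v x * v z else 0)"
    unfolding energy_def T_def by (rule sum.swap)
  also have "\<dots> = (\<Sum>x\<in>S. \<Sum>z\<in>S. \<Sum>i\<in>T \<times> T.
     if prod_list (fst i) * x = prod_list (snd i) * z then v x * v z else 0)"
    by (intro sum.cong refl sum.swap)
  also have "\<dots> = (\<Sum>x\<in>S. \<Sum>z\<in>S. v x * v z * (\<Sum>i\<in>T \<times> T.
     if prod_list (fst i) * x = prod_list (snd i) * z then 1 else 0))"
    by (intro sum.cong refl) (auto simp: sum_distrib_left intro!: sum.cong)
  also have "\<dots> \<le> (\<Sum>x\<in>S. \<Sum>z\<in>S. v x * v z * (real X ^ k * B))"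
    using v cnt by (intro sum_mono mult_left_mono) auto
  also have "\<dots> = (\<Sum>x\<in>S. v x)\<^sup>2 * (real X ^ k * B)"
    by (simp only: power2_eq_square sum_product) (simp only: sum_distrib_right)
  finally show ?thesis by (simp add: B_def)
qed

text \<open>
  The number of pairs with a ratio of small height is bounded by raising the associated
  convolution operator to a high power, where the divisor bound controls its kernel.
\<close>

lemma sum_pairs_small_height_le:
  fixes \<theta> :: real
  assumes \<theta>: "\<theta> > 0"
  obtains C where "C > 0"
    "\<And>X S v. X \<ge> 1 \<Longrightarrow> finite S \<Longrightarrow> 0 \<notin> S \<Longrightarrow> (\<And>x. x \<in> S \<Longrightarrow> 0 \<le> v x \<and> v x \<le> 1) \<Longrightarrow>
      (\<Sum>x\<in>S. v x) \<ge> 1 \<Longrightarrow>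
      (\<Sum>m\<in>S. \<Sum>n\<in>S. if m div gcd m n \<le> X \<and> n div gcd m n \<le> X then v m * v n else 0)
        \<le> C * real X powr (1 + \<theta>) * (\<Sum>x\<in>S. v x) powr (1 + \<theta>)"
proof -
  \<comment> \<open>\<open>k \<ge> 1 / \<theta>\<close> brings the exponent \<open>1 + 1 / k\<close>
    of the total weight below \<open>1 + \<theta>\<close>. With \<open>\<eta> = \<theta> / k\<close>
    the divisor bound for numbers up to \<open>X ^ k\<close> costs \<open>X powr \<theta>\<close>
    once the \<open>k\<close>-th root is taken.\<close>
  obtain s where s: "1 / \<theta> < 2 ^ s" using real_arch_pow[of 2 "1 / \<theta>"] by auto
  define k :: nat where "k = 2 ^ s"
  have k: "k > 0" by (simp add: k_def)
  have k\<theta>: "1 / real k \<le> \<theta>" using s \<theta> by (simp add: k_def field_simps)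
  define \<eta> where "\<eta> = \<theta> / k"
  have \<eta>: "\<eta> > 0" using \<theta> k by (simp add: \<eta>_def)
  obtain C where C1: "C \<ge> 1" and C: "\<And>n::nat. n > 0 \<Longrightarrow> real (card {d. d dvd n}) \<le> C * real n powr \<eta>"
    using card_divisors_le_powr[OF \<eta>] by blast
  show thesis
  proof (rule that[of C])
    show "C > 0" using C1 by simp
    fix X :: nat and S and v :: "nat \<Rightarrow> real"
    assume X: "X \<ge> 1" and S: "finite S" "0 \<notin> S" and v: "\<And>x. x \<in> S \<Longrightarrow> 0 \<le> v x \<and> v x \<le> 1"
      and M1: "(\<Sum>x\<in>S. v x) \<ge> 1"
    define M where "M = (\<Sum>x\<in>S. v x)"
    have M: "M \<ge> 1" using M1 by (simp add: M_def)
    have v0: "\<And>x. x \<in> S \<Longrightarrow> v x \<ge> 0" using v by blast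
    have V: "(\<Sum>x\<in>S. (v x)\<^sup>2) \<le> M"
      unfolding M_def power2_eq_square using v by (intro sum_mono) (simp add: mult_left_le)
    have V0: "(\<Sum>x\<in>S. (v x)\<^sup>2) \<ge> 0" by (simp add: sum_nonneg)
    define R where "R = C * real X powr (1 + \<theta>) * M powr (1 + 1 / real k)"
    have "energy X 1 S v ^ k \<le> (\<Sum>x\<in>S. (v x)\<^sup>2) ^ (k - 1) * energy X k S v"
      unfolding k_def by (rule energy_power_le[OF S(1) v0])
    also have "\<dots> \<le> M ^ (k - 1) * (M\<^sup>2 * (real X ^ k * (C * real (X ^ k) powr \<eta>) ^ k))"
      using energy_le[OF C less_imp_le[OF \<eta>] X C1 S v0, where k = k] V V0 M
      by (intro mult_mono power_mono) (auto simp: M_def energy_nonneg[OF v0])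
    also have "\<dots> = M ^ (k + 1) * (real X ^ k * (C * real (X ^ k) powr \<eta>) ^ k)"
    proof -
      have "M ^ (k - 1) * M\<^sup>2 = M ^ (k + 1)" using k by (simp flip: power_add)
      then show ?thesis by (simp only: mult.assoc[symmetric])
    qed
    also have "\<dots> = R ^ k"
    proof -
      have "real (X ^ k) powr \<eta> = real X powr \<theta>"
        using X k by (simp add: \<eta>_def powr_realpow[symmetric] powr_powr)
      moreover have "M ^ (k + 1) = (M powr (1 + 1 / real k)) ^ k"
      proof -
        have "(M powr (1 + 1 / real k)) ^ k = M powr ((1 + 1 / real k) * real k)"
          using M by (simp add: powr_powr[symmetric] powr_realpow)
        also have "(1 + 1 / real k) * real k = real (k + 1)" using k by (simp add: field_simps)
        also have "M powr real (k + 1) = M ^ (k + 1)" using M by (subst powr_realpow) auto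
        finally show ?thesis by simp
      qed
      ultimately show ?thesis using X by (simp add: R_def power_mult_distrib powr_add mult_ac)
    qed
    finally have "energy X 1 S v ^ k \<le> R ^ k" .
    moreover have "R \<ge> 0" using C1 by (simp add: R_def)
    ultimately have ER: "energy X 1 S v \<le> R"
      using k by (metis power_le_imp_le_base Suc_pred')
    have "(\<Sum>m\<in>S. \<Sum>n\<in>S. if m div gcd m n \<le> X \<and> n div gcd m n \<le> X then v m * v n else 0)
      \<le> (\<Sum>m\<in>S. \<Sum>n\<in>S. \<Sum>i\<in>tuples X 1 \<times> tuples X 1.
           if prod_list (fst i) * m = prod_list (snd i) * n then v m * v n else 0)"
    proof (intro sum_mono)
      fix m n assume mn: "m \<in> S" "n \<in> S"
      have nn: "0 \<le> v m * v n" using v0 mn by simp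
      let ?f = "\<lambda>i. if prod_list (fst i) * m = prod_list (snd i) * n then v m * v n else 0"
      have f0: "?f i \<ge> 0" for i using nn by simp
      show "(if m div gcd m n \<le> X \<and> n div gcd m n \<le> X then v m * v n else 0)
        \<le> sum ?f (tuples X 1 \<times> tuples X 1)"
      proof (cases "m div gcd m n \<le> X \<and> n div gcd m n \<le> X")
        case True
        have mn0: "m > 0" "n > 0" using mn S by (auto intro: Nat.gr0I)
        let ?i = "([n div gcd m n], [m div gcd m n])"
        have "n div gcd m n > 0" "m div gcd m n > 0"
          using mn0 by (auto simp: div_greater_zero_iff intro: gcd_le1_nat gcd_le2_nat)
        then have "?i \<in> tuples X 1 \<times> tuples X 1" using True by (auto simp: tuples_def Suc_le_eq)
        then have "?f ?i \<le> sum ?f (tuples X 1 \<times> tuples X 1)"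
          using f0 by (intro member_le_sum) (auto simp: finite_tuples)
        moreover have "n div gcd m n * m = m div gcd m n * n"
          by (metis div_mult_swap dvd_div_mult gcd_dvd1 gcd_dvd2 mult.commute)
        ultimately show ?thesis using True by simp
      next
        case False
        then show ?thesis using f0 by (simp only: if_False) (rule sum_nonneg, simp)
      qed
    qed
    also have "\<dots> = (\<Sum>m\<in>S. \<Sum>i\<in>tuples X 1 \<times> tuples X 1. \<Sum>n\<in>S.
           if prod_list (fst i) * m = prod_list (snd i) * n then v m * v n else 0)"
      by (intro sum.cong refl sum.swap)
    also have "\<dots> = energy X 1 S v"
      unfolding energy_def by (rule sum.swap)
    also note ER
    also have "R \<le> C * real X powr (1 + \<theta>) * M powr (1 + \<theta>)"
      unfolding R_def using C1 M k\<theta> by (intro mult_left_mono powr_mono) auto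
    finally show "(\<Sum>m\<in>S. \<Sum>n\<in>S. if m div gcd m n \<le> X \<and> n div gcd m n \<le> X then v m * v n else 0)
        \<le> C * real X powr (1 + \<theta>) * (\<Sum>x\<in>S. v x) powr (1 + \<theta>)" by (simp add: M_def)
  qed
qed

subsection \<open>A sieve bound at the logarithmic scale\<close>

lemma sum_mod_mult_coprime:
  fixes f g :: "nat \<Rightarrow> real"
  assumes "coprime m n" "m > 0" "n > 0"
  shows "(\<Sum>c<m * n. f (c mod m) * g (c mod n)) = (\<Sum>r<m. f r) * (\<Sum>r<n. g r)"
proof -
  let ?h = "\<lambda>c. (c mod m, c mod n)"
  have inj: "inj_on ?h {..<m * n}"
  proof (rule inj_onI)
    fix x y assume xy: "x \<in> {..<m * n}" "y \<in> {..<m * n}" "?h x = ?h y"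
    then have "[x = y] (mod m)" "[x = y] (mod n)" by (auto simp: cong_def)
    then have "[x = y] (mod m * n)" using assms(1) by (intro coprime_cong_mult_nat)
    then show "x = y" using xy by (auto simp: cong_def)
  qed
  have "?h ` {..<m * n} = {..<m} \<times> {..<n}"
    using assms by (intro card_subset_eq) (auto simp: card_image[OF inj])
  then have "(\<Sum>p\<in>{..<m} \<times> {..<n}. f (fst p) * g (snd p)) = (\<Sum>c<m * n. f (c mod m) * g (c mod n))"
    using sum.reindex[OF inj, of "\<lambda>p. f (fst p) * g (snd p)"] by simp
  then show ?thesis by (simp add: sum_product sum.cartesian_product case_prod_beta)
qed

lemma sum_mod_multiple:
  fixes h :: "nat \<Rightarrow> real"
  shows "(\<Sum>c<k * P. h (c mod P)) = real k * (\<Sum>r<P. h r)"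
proof -
  have "(\<Sum>c<k * P. h (c mod P)) = (\<Sum>j<k. \<Sum>c=j * P..<j * P + P. h (c mod P))"
    by (rule sum.nat_group[symmetric])
  also have "\<dots> = (\<Sum>j<k. \<Sum>r<P. h r)"
  proof (rule sum.cong[OF refl])
    fix j
    have "(\<Sum>c=j * P..<j * P + P. h (c mod P)) = (\<Sum>r = 0..<P. h ((r + j * P) mod P))"
      using sum.shift_bounds_nat_ivl[of "\<lambda>c. h (c mod P)" 0 "j * P" P] by (simp add: add.commute)
    also have "\<dots> = (\<Sum>r<P. h r)" by (intro sum.cong) auto
    finally show "(\<Sum>c=j * P..<j * P + P. h (c mod P)) = (\<Sum>r<P. h r)" .
  qed
  finally show ?thesis by simp
qed

text \<open>By the Chinese remainder theorem the residues modulo distinct primes are independent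
  over a full period, so the mean factors exactly, without an error term.\<close>

lemma sum_prod_mod_primes:
  fixes f :: "nat \<Rightarrow> nat \<Rightarrow> real"
  assumes "finite F" "\<And>p. p \<in> F \<Longrightarrow> prime p" "\<Prod>F dvd N"
  shows "(\<Sum>c<N. \<Prod>p\<in>F. f p (c mod p)) = real N * (\<Prod>p\<in>F. (\<Sum>r<p. f p r) / real p)"
proof -
  have main: "(\<Sum>c<\<Prod>F. \<Prod>p\<in>F. f p (c mod p)) = (\<Prod>p\<in>F. \<Sum>r<p. f p r)"
    using assms(1,2)
  proof (induction F rule: finite_induct)
    case (insert q F)
    have q: "prime q" and F: "\<And>p. p \<in> F \<Longrightarrow> prime p" using insert.prems by auto
    have cop: "coprime q (\<Prod>F)"
      using insert.hyps q F by (intro prod_coprime_right) (auto intro!: primes_coprime)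
    have pos: "\<Prod>F > 0" using F by (intro prod_pos prime_gt_0_nat)
    have mm: "c mod \<Prod>F mod p = c mod p" if "p \<in> F" for c p
      using that insert.hyps by (intro mod_mod_cancel dvd_prodI) auto
    have "(\<Sum>c<\<Prod>(insert q F). \<Prod>p\<in>insert q F. f p (c mod p))
      = (\<Sum>c<q * \<Prod>F. f q (c mod q) * (\<lambda>r. \<Prod>p\<in>F. f p (r mod p)) (c mod \<Prod>F))"
      using insert.hyps mm by (intro sum.cong) (auto intro!: prod.cong)
    also have "\<dots> = (\<Sum>r<q. f q r) * (\<Sum>r<\<Prod>F. \<Prod>p\<in>F. f p (r mod p))"
      using cop prime_gt_0_nat[OF q] pos by (rule sum_mod_mult_coprime)
    finally show ?case using insert by simp
  qed simp
  obtain k where k: "N = k * \<Prod>F" using assms(3) by (metis dvd_def mult.commute)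
  have P: "real (\<Prod>F) > 0" unfolding of_nat_0_less_iff using assms(2) by (intro prod_pos prime_gt_0_nat)
  have mm: "c mod \<Prod>F mod p = c mod p" if "p \<in> F" for c p
    using that assms(1) by (intro mod_mod_cancel dvd_prodI) auto
  have "(\<Sum>c<N. \<Prod>p\<in>F. f p (c mod p)) = (\<Sum>c<k * \<Prod>F. (\<lambda>r. \<Prod>p\<in>F. f p (r mod p)) (c mod \<Prod>F))"
    unfolding k by (intro sum.cong refl) (auto simp: mm intro!: prod.cong)
  also have "\<dots> = real k * (\<Sum>r<\<Prod>F. \<Prod>p\<in>F. f p (r mod p))"
    by (rule sum_mod_multiple)
  also have "\<dots> = real N * (\<Prod>p\<in>F. (\<Sum>r<p. f p r) / real p)"
    using P by (simp add: main k prod_dividef field_simps)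
  finally show ?thesis .
qed

section \<open>Prime factors above the sieving limit\<close>

lemma exp_minus_two_le: "exp (-2) \<le> (1 - 1 / real (y + 1)) ^ (y + 1)" if "y \<ge> 1"
proof -
  have "(1 + 1 / real y) ^ (y + 1) \<le> exp (1 / real y) ^ (y + 1)"
    by (intro power_mono exp_ge_add_one_self) simp
  also have "\<dots> = exp (real (y + 1) * (1 / real y))" by (rule exp_of_nat_mult[symmetric])
  also have "\<dots> \<le> exp 2" using that by (auto simp: field_simps)
  finally have le: "(1 + 1 / real y) ^ (y + 1) \<le> exp 2" .
  have eq: "1 - 1 / real (y + 1) = 1 / (1 + 1 / real y)" using that by (simp add: field_simps)
  have "(1 - 1 / real (y + 1)) ^ (y + 1) = 1 / (1 + 1 / real y) ^ (y + 1)"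
    unfolding eq by (simp add: power_one_over)
  moreover have "1 / (1 + 1 / real y) ^ (y + 1) \<ge> 1 / exp 2"
    using le that by (intro divide_left_mono) (auto intro!: mult_pos_pos zero_less_power add_pos_nonneg)
  ultimately show ?thesis by (simp add: exp_minus inverse_eq_divide)
qed

lemma prod_large_primes_ge:
  assumes n: "n > 0" and y: "y \<ge> 1" and less: "n < (y + 1) ^ k"
  shows "(\<Prod>p\<in>{p \<in> prime_factors n. y < p}. 1 - 1 / real p) \<ge> (1 - 1 / real (y + 1)) ^ k"
proof -
  define G where "G = {p \<in> prime_factors n. y < p}"
  define j where "j = card G"
  have fG: "finite G" unfolding G_def by (rule finite_subset[of _ "prime_factors n"]) auto
  have "(y + 1) ^ j = (\<Prod>p\<in>G. y + 1)" by (simp add: j_def)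
  also have "\<dots> \<le> \<Prod>G" by (intro prod_mono) (auto simp: G_def)
  also have "\<dots> \<le> n"
  proof (rule dvd_imp_le)
    have "\<Prod>G dvd \<Prod>(prime_factors n)" by (intro prod_dvd_prod_subset) (auto simp: G_def)
    also have "\<dots> dvd n" using n by (rule prod_prime_factors_dvd)
    finally show "\<Prod>G dvd n" .
  qed (use n in simp)
  finally have "(y + 1) ^ j < (y + 1) ^ k" using less by linarith
  then have jk: "j < k" using y by (simp add: power_strict_increasing_iff)
  have "(1 - 1 / real (y + 1)) ^ k \<le> (1 - 1 / real (y + 1)) ^ j"
    using jk y by (intro power_decreasing) (auto simp: field_simps)
  also have "\<dots> = (\<Prod>p\<in>G. 1 - 1 / real (y + 1))" by (simp add: j_def)
  also have "\<dots> \<le> (\<Prod>p\<in>G. 1 - 1 / real p)"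
    using y by (intro prod_mono) (auto simp: G_def field_simps)
  finally show ?thesis by (simp add: G_def)
qed

text \<open>There are fewer than \<open>(y + 1) * B\<close> prime factors above \<open>y\<close>, as
  their product is at most \<open>n\<close>. Each contributes at least
  \<open>1 - 1 / (y + 1)\<close>, and \<open>y + 1\<close> such factors multiply to at least
  \<open>exp (-2)\<close>.\<close>

lemma totient_ratio_ge_small_primes:
  assumes n: "n > 0" and y: "y \<ge> 1" and less: "n < (y + 1) ^ ((y + 1) * B)"
  shows "totient_ratio n \<ge> exp (-2 * real B) * (\<Prod>p\<in>{p \<in> prime_factors n. p \<le> y}. 1 - 1 / real p)"
proof -
  define L where "L = (\<Prod>p\<in>{p \<in> prime_factors n. p \<le> y}. 1 - 1 / real p)"
  define U where "U = (\<Prod>p\<in>{p \<in> prime_factors n. y < p}. 1 - 1 / real p)"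
  have L0: "L \<ge> 0" unfolding L_def
    by (intro prod_nonneg) (auto dest!: in_prime_factors_imp_prime prime_gt_0_nat simp: field_simps)
  have "totient_ratio n = (\<Prod>p\<in>{p \<in> prime_factors n. p \<le> y} \<union> {p \<in> prime_factors n. y < p}. 1 - 1 / real p)"
    unfolding totient_ratio_prod[OF n] by (rule prod.cong) auto
  also have "\<dots> = L * U"
    unfolding L_def U_def
    by (intro prod.union_disjoint) (auto intro: finite_subset[of _ "prime_factors n"])
  finally have eq: "totient_ratio n = L * U" .
  have "exp (-2 * real B) = exp (-2) ^ B" by (simp add: exp_of_nat_mult[symmetric] mult.commute)
  also have "\<dots> \<le> ((1 - 1 / real (y + 1)) ^ (y + 1)) ^ B"
    using y by (intro power_mono exp_minus_two_le) auto
  also have "\<dots> = (1 - 1 / real (y + 1)) ^ ((y + 1) * B)" by (simp only: power_mult)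
  also have "\<dots> \<le> U" unfolding U_def by (rule prod_large_primes_ge[OF n y less])
  finally have "exp (-2 * real B) \<le> U" .
  then have "exp (-2 * real B) * L \<le> U * L" using L0 by (rule mult_right_mono)
  then show ?thesis unfolding eq L_def by (simp add: mult.commute)
qed

lemma prod_one_plus_le_exp:
  fixes F :: "nat set"
  assumes "finite F" "\<And>p. p \<in> F \<Longrightarrow> 2 \<le> p"
  shows "(\<Prod>p\<in>F. 1 + 1 / (real p * (real p - 1))) \<le> exp 1"
proof -
  \<comment> \<open>The exponents telescope:
    \<open>1 / (p * (p - 1)) = 1 / (p - 1) - 1 / p\<close>.\<close>
  have *: "(\<Prod>p\<in>{2..m + 1}. 1 + 1 / (real p * (real p - 1))) \<le> exp (1 - 1 / real (m + 1))" for m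
  proof (induction m)
    case (Suc m)
    have "(\<Prod>p\<in>{2..Suc m + 1}. 1 + 1 / (real p * (real p - 1)))
      = (\<Prod>p\<in>{2..m + 1}. 1 + 1 / (real p * (real p - 1))) * (1 + 1 / (real (m + 2) * (real (m + 2) - 1)))"
      by (simp add: prod.atLeast_Suc_atMost mult.commute)
    also have "\<dots> \<le> exp (1 - 1 / real (m + 1)) * exp (1 / (real (m + 2) * (real (m + 2) - 1)))"
      using Suc.IH by (intro mult_mono exp_ge_add_one_self) auto
    also have "\<dots> = exp (1 - 1 / real (Suc m + 1))"
      unfolding exp_add[symmetric]
      by (simp add: divide_simps add_nonneg_eq_0_iff) (simp add: algebra_simps)
    finally show ?case .
  qed simp
  define m where "m = Max (insert 1 F)"
  have "p \<le> m" if "p \<in> F" for p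
    using that assms(1) unfolding m_def by (intro Max_ge) auto
  then have "F \<subseteq> {2..m + 1}" using assms(2) by (force intro: le_SucI)
  then have "(\<Prod>p\<in>F. 1 + 1 / (real p * (real p - 1))) \<le> (\<Prod>p\<in>{2..m + 1}. 1 + 1 / (real p * (real p - 1)))"
    by (intro prod_mono2) auto
  also have "\<dots> \<le> exp (1 - 1 / real (m + 1))" by (rule *)
  also have "\<dots> \<le> exp 1" by simp
  finally show ?thesis .
qed

text \<open>
  With \<open>y ^ y \<le> Z < (y + 1) ^ (y + 1)\<close> the product of the primes up to \<open>y\<close> is at most \<open>Z\<close>, so these
  can be sieved by exact periodicity, while an integer that is polynomial in \<open>Z\<close> has only
  \<open>O(y)\<close> prime factors above \<open>y\<close>, which contribute a bounded factor.
\<close>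

lemma sum_coprime_inverse_totient_ratio_le:
  assumes Z: "Z \<ge> 1" and q: "q > 0" "q \<le> Z ^ B" and B: "B \<ge> 1"
  shows "(\<Sum>c\<in>{c \<in> {1..Z}. coprime c q}. 1 / totient_ratio c)
    \<le> 2 * exp (3 + 2 * real B) * real Z * totient_ratio q"
proof -
  define y where "y = (LEAST y. Z < (y + 1) ^ (y + 1))"
  have "Z < (Z + 1) ^ (Z + 1)"
    using self_le_power[of "Z + 1" "Z + 1"] by linarith
  then have y1: "Z < (y + 1) ^ (y + 1)" unfolding y_def by (rule LeastI)
  have y: "y \<ge> 1"
  proof (rule ccontr)
    assume "\<not> 1 \<le> y" then have "y = 0" by simp
    then show False using y1 Z by simp
  qed
  have y2: "y ^ y \<le> Z"
  proof (rule ccontr)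
    assume "\<not> y ^ y \<le> Z"
    then have "Z < (y - 1 + 1) ^ (y - 1 + 1)" using y by simp
    then have "y \<le> y - 1" unfolding y_def by (rule Least_le)
    then show False using y by simp
  qed
  define F where "F = {p. prime p \<and> p \<le> y}"
  have fF: "finite F" by (simp add: F_def)
  have pF: "\<And>p. p \<in> F \<Longrightarrow> prime p" by (simp add: F_def)
  have p2: "\<And>p. p \<in> F \<Longrightarrow> p \<ge> 2" using pF prime_ge_2_nat by blast
  define P where "P = \<Prod>F"
  have P0: "P > 0" unfolding P_def using pF by (intro prod_pos prime_gt_0_nat)
  have "P \<le> (\<Prod>p\<in>F. y)" unfolding P_def by (intro prod_mono) (auto simp: F_def)
  also have "\<dots> = y ^ card F" by simp
  also have "\<dots> \<le> y ^ y"
  proof (rule power_increasing)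
    have "card F \<le> card {1..y}" by (intro card_mono) (auto simp: F_def Suc_le_eq dest: prime_gt_0_nat)
    then show "card F \<le> y" by simp
  qed (use y in simp)
  finally have PZ: "P \<le> Z" using y2 by linarith
  \<comment> \<open>The first multiple of the period \<open>P\<close> beyond \<open>Z\<close>.
    Positivity allows the sum to be extended to this full range, at the price of a factor 2 since
    \<open>P \<le> Z\<close>.\<close>
  define N where "N = (Z div P + 1) * P"
  have NZ: "Z < N"
    using P0 by (simp add: N_def dividend_less_div_times)
  have N2: "N \<le> 2 * Z"
  proof -
    have "Z div P * P \<le> Z" by (rule div_times_less_eq_dividend)
    then show ?thesis using PZ unfolding N_def distrib_right by linarith
  qed
  \<comment> \<open>The local weight at \<open>p\<close>: it kills multiples of \<open>p\<close>
    when coprimality to \<open>q\<close> forbids them, and otherwise gives them the factor of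
    \<open>1 / totient_ratio c\<close> at \<open>p\<close>. Its mean is \<open>1 - 1 / p\<close> if
    \<open>p dvd q\<close>, and \<open>1 + 1 / (p * (p - 1))\<close> if not.\<close>
  define f where "f = (\<lambda>p (r::nat). if r = 0 then (if p dvd q then 0 else 1 / (1 - 1 / real p)) else (1::real))"
  have f0: "f p r \<ge> 0" if "p \<in> F" for p r using p2[OF that] by (auto simp: f_def field_simps)
  have ptw: "1 / totient_ratio c \<le> exp 2 * (\<Prod>p\<in>F. f p (c mod p))"
    if c: "c \<in> {1..Z}" "coprime c q" for c
  proof -
    define Lc where "Lc = (\<Prod>p\<in>{p \<in> prime_factors c. p \<le> y}. 1 - 1 / real p)"
    have c0: "c > 0" using c by simp
    have Lpos: "Lc > 0" unfolding Lc_def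
      by (intro prod_pos) (auto dest!: in_prime_factors_imp_prime prime_gt_1_nat simp: field_simps)
    have "totient_ratio c \<ge> exp (-2 * real 1) * Lc"
      unfolding Lc_def using c y1 y by (intro totient_ratio_ge_small_primes) auto
    then have "1 / totient_ratio c \<le> 1 / (exp (-2) * Lc)"
      using Lpos totient_ratio_pos[OF c0] by (intro divide_left_mono) auto
    also have "\<dots> = exp 2 * (1 / Lc)" by (simp add: exp_minus field_simps)
    also have "1 / Lc = (\<Prod>p\<in>{p \<in> prime_factors c. p \<le> y}. 1 / (1 - 1 / real p))"
      by (simp add: Lc_def prod_dividef)
    also have "\<dots> = (\<Prod>p\<in>{p \<in> F. p dvd c}. 1 / (1 - 1 / real p))"
      using c0 by (intro prod.cong) (auto simp: F_def in_prime_factors_iff)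
    also have "\<dots> = (\<Prod>p\<in>F. if p dvd c then 1 / (1 - 1 / real p) else 1)"
      using fF by (rule prod.inter_filter)
    also have "\<dots> = (\<Prod>p\<in>F. f p (c mod p))"
    proof (rule prod.cong[OF refl])
      fix p assume p: "p \<in> F"
      have "\<not> p dvd q" if "p dvd c"
        using that c(2) pF[OF p] by (meson coprime_common_divisor not_prime_unit)
      then show "(if p dvd c then 1 / (1 - 1 / real p) else 1) = f p (c mod p)"
        by (auto simp: f_def mod_eq_0_iff_dvd)
    qed
    finally show ?thesis by simp
  qed
  define Lq where "Lq = (\<Prod>p\<in>{p \<in> prime_factors q. p \<le> y}. 1 - 1 / real p)"
  \<comment> \<open>The sieve detects only the primes of \<open>q\<close> up to \<open>y\<close>. As
    \<open>q\<close> is polynomial in \<open>Z\<close>, the larger ones change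
    \<open>totient_ratio q\<close> by a bounded factor.\<close>
  have Lq: "exp (-2 * real B) * Lq \<le> totient_ratio q"
    unfolding Lq_def
  proof (rule totient_ratio_ge_small_primes[OF q(1) y])
    show "q < (y + 1) ^ ((y + 1) * B)"
    proof -
      have "Z ^ B < ((y + 1) ^ (y + 1)) ^ B" using y1 B by (intro power_strict_mono) auto
      then show ?thesis using q by (simp only: power_mult)
    qed
  qed
  have avg: "0 \<le> (\<Sum>r<p. f p r) / real p \<and> (\<Sum>r<p. f p r) / real p
     \<le> (if p dvd q then 1 - 1 / real p else 1) * (1 + 1 / (real p * (real p - 1)))" if p: "p \<in> F" for p
  proof -
    have p2': "real p \<ge> 2" using p2[OF p] by simp
    have "{..<p} = insert 0 {1..<p}" using p2[OF p] by auto
    then have "(\<Sum>r<p. f p r) = f p 0 + (\<Sum>r=1..<p. f p r)" by simp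
    also have "(\<Sum>r=1..<p. f p r) = (\<Sum>r=1..<p. 1)" by (intro sum.cong) (auto simp: f_def)
    finally have eq: "(\<Sum>r<p. f p r) = f p 0 + (real p - 1)" using p2[OF p] by simp
    show ?thesis
    proof (cases "p dvd q")
      case True
      then have "f p 0 = 0" by (simp add: f_def)
      then have avg_eq: "(\<Sum>r<p. f p r) / real p = 1 - 1 / real p"
        using eq p2' by (simp add: field_simps)
      have "(1 - 1 / real p) * 1 \<le> (1 - 1 / real p) * (1 + 1 / (real p * (real p - 1)))"
        using p2' by (intro mult_left_mono) auto
      then show ?thesis using True p2' by (simp add: avg_eq)
    next
      case False
      then have "f p 0 = 1 / (1 - 1 / real p)" by (simp add: f_def)
      then have sum_eq: "(\<Sum>r<p. f p r) = 1 / (1 - 1 / real p) + (real p - 1)" using eq by simp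
      have "(\<Sum>r<p. f p r) / real p = 1 + 1 / (real p * (real p - 1))"
        unfolding sum_eq using p2' by (simp add: field_simps)
      then show ?thesis using False p2' by simp
    qed
  qed
  have "(\<Sum>c\<in>{c \<in> {1..Z}. coprime c q}. 1 / totient_ratio c)
     \<le> (\<Sum>c\<in>{c \<in> {1..Z}. coprime c q}. exp 2 * (\<Prod>p\<in>F. f p (c mod p)))"
    using ptw by (intro sum_mono) auto
  also have "\<dots> \<le> (\<Sum>c<N. exp 2 * (\<Prod>p\<in>F. f p (c mod p)))"
    using NZ by (intro sum_mono2 mult_nonneg_nonneg prod_nonneg f0) auto
  also have "\<dots> = exp 2 * (\<Sum>c<N. \<Prod>p\<in>F. f p (c mod p))" by (simp add: sum_distrib_left)
  also have "(\<Sum>c<N. \<Prod>p\<in>F. f p (c mod p)) = real N * (\<Prod>p\<in>F. (\<Sum>r<p. f p r) / real p)"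
  proof (rule sum_prod_mod_primes[OF fF pF])
    show "\<Prod>F dvd N" unfolding N_def P_def by (rule dvd_triv_right)
  qed
  also have "(\<Prod>p\<in>F. (\<Sum>r<p. f p r) / real p)
    \<le> (\<Prod>p\<in>F. (if p dvd q then 1 - 1 / real p else 1) * (1 + 1 / (real p * (real p - 1))))"
    using avg by (intro prod_mono) auto
  also have "\<dots> = Lq * (\<Prod>p\<in>F. 1 + 1 / (real p * (real p - 1)))"
  proof -
    have "(\<Prod>p\<in>F. if p dvd q then 1 - 1 / real p else 1) = (\<Prod>p\<in>{p \<in> F. p dvd q}. 1 - 1 / real p)"
      using fF by (rule prod.inter_filter[symmetric])
    also have "\<dots> = Lq"
      unfolding Lq_def using q(1) by (intro prod.cong) (auto simp: F_def in_prime_factors_iff)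
    finally show ?thesis by (simp add: prod.distrib)
  qed
  also have "\<dots> \<le> Lq * exp 1"
  proof (rule mult_left_mono)
    show "0 \<le> Lq" unfolding Lq_def
      by (intro prod_nonneg) (auto dest!: in_prime_factors_imp_prime prime_gt_0_nat simp: field_simps)
  qed (use prod_one_plus_le_exp[OF fF p2] in auto)
  also have "Lq \<le> exp (2 * real B) * totient_ratio q"
    using Lq by (simp add: exp_minus field_simps)
  finally have "(\<Sum>c\<in>{c \<in> {1..Z}. coprime c q}. 1 / totient_ratio c)
    \<le> exp 2 * (real N * (exp (2 * real B) * totient_ratio q * exp 1))"
    by (simp add: mult_left_mono)
  \<comment> \<open>The exponent collects 2 from the large primes of \<open>c\<close>, 1 from the
    convergent product, and \<open>2 * B\<close> from the large primes of \<open>q\<close>.\<close>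
  also have "\<dots> = exp (3 + 2 * real B) * totient_ratio q * real N"
    by (simp add: exp_add[symmetric] mult_ac)
  also have "\<dots> \<le> exp (3 + 2 * real B) * totient_ratio q * (2 * real Z)"
    using N2 totient_ratio_pos[OF q(1)] by (intro mult_left_mono) auto
  finally show ?thesis by (simp add: mult_ac)
qed

subsection \<open>Overlaps of two approximation sets\<close>

lemma linear_congruence_solution:
  fixes s a :: int
  assumes "prime p" "\<not> int p dvd a"
  obtains r where "r < p" "int p dvd s + a * int r"
proof -
  have p0: "p > 0" using assms(1) prime_gt_0_nat by blast
  have "coprime a (int p)" using assms by (metis coprime_commute prime_imp_coprime prime_nat_int_transfer)
  then obtain a' where a': "[a * a' = 1] (mod int p)" using cong_solve_coprime_int by blast
  define r where "r = nat ((- s * a') mod int p)"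
  have r: "int r = (- s * a') mod int p" using p0 by (simp add: r_def)
  have "r < p" using p0 by (simp add: r_def nat_less_iff)
  moreover have "int p dvd s + a * int r"
  proof -
    have "[s + a * int r = s + a * (- s * a')] (mod int p)"
      unfolding r by (intro cong_add cong_mult cong_refl) simp
    also have "s + a * (- s * a') = s - s * (a * a')" by (simp add: algebra_simps)
    also have "[s - s * (a * a') = s - s * 1] (mod int p)"
      by (intro cong_diff cong_mult cong_refl a')
    finally show ?thesis by (simp add: cong_0_iff)
  qed
  ultimately show thesis by (rule that)
qed

text \<open>These are the reduced fractions \<open>s / m\<close> and \<open>t / n\<close> in
  \<open>[0, 1)\<close> with difference \<open>c / lcm m n\<close>.\<close>

definition coprime_pairs :: "nat \<Rightarrow> nat \<Rightarrow> int \<Rightarrow> (int \<times> int) set" where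
  "coprime_pairs m n c = {(s, t). s \<in> {0..<int m} \<and> t \<in> {0..<int n} \<and> coprime s (int m) \<and> coprime t (int n) \<and>
     s * int (n div gcd m n) - t * int (m div gcd m n) = c}"

text \<open>Since \<open>a\<close> and \<open>b\<close> are coprime, all solutions lie on the line
  \<open>(s0 + a * j, t0 + b * j)\<close>, and \<open>j\<close> matters only modulo
  \<open>g\<close>. At a prime \<open>p\<close> of \<open>g\<close> neither coordinate may vanish
  modulo \<open>p\<close>. This excludes at least one residue of \<open>j\<close>, and two different
  residues if \<open>p\<close> divides none of \<open>a\<close>, \<open>b\<close>,
  \<open>c\<close>.\<close>

lemma card_coprime_pairs_le:
  assumes m: "m > 0" and n: "n > 0"
  defines "g \<equiv> gcd m n"
  defines "a \<equiv> m div g" and "b \<equiv> n div g"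
  shows "real (card (coprime_pairs m n c)) \<le> real g * totient_ratio g *
     (\<Prod>p\<in>{p \<in> prime_factors g. \<not> int p dvd int (a * b) * c}. 1 - 1 / real p)"
proof (cases "coprime_pairs m n c = {}")
  case True
  have "0 \<le> real g * totient_ratio g * (\<Prod>p\<in>{p \<in> prime_factors g. \<not> int p dvd int (a * b) * c}. 1 - 1 / real p)"
    by (intro mult_nonneg_nonneg prod_nonneg)
      (auto simp: totient_ratio_def field_simps dest!: in_prime_factors_imp_prime prime_gt_0_nat)
  then show ?thesis using True by simp
next
  case False
  then obtain s0 t0 where st0: "(s0, t0) \<in> coprime_pairs m n c" by auto
  have g0: "g > 0" using m by (simp add: g_def)
  have ma: "m = g * a" and nb: "n = g * b" by (simp_all add: a_def b_def g_def)
  have cab: "coprime a b" unfolding a_def b_def g_def using m by (intro div_gcd_coprime) simp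
  have a0: "a > 0" and b0: "b > 0" using m n ma nb by (auto intro: Nat.gr0I)
  define Q where "Q = coprime_pairs m n c"
  have c0: "s0 * int b - t0 * int a = c" using st0 by (simp add: coprime_pairs_def a_def b_def g_def)
  define f where "f = (\<lambda>p r. if \<not> int p dvd s0 + int a * int r \<and> \<not> int p dvd t0 + int b * int r then 1 else (0::real))"
  define J where "J = {j \<in> {..<g}. \<forall>p\<in>prime_factors g. f p (j mod p) = 1}"
  have pf: "prime p" "p dvd g" if "p \<in> prime_factors g" for p
    using that by auto
  \<comment> \<open>Recovers the parameter \<open>j\<close> modulo \<open>g\<close>. It is injective
    because shifting \<open>j\<close> by a multiple of \<open>g\<close> shifts \<open>s\<close> by a
    multiple of \<open>m\<close>, while \<open>s\<close> is confined to one period.\<close>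
  define \<phi> where "\<phi> = (\<lambda>(s, t :: int). nat (((s - s0) div int a) mod int g))"
  have par: "\<exists>j. s = s0 + int a * j \<and> t = t0 + int b * j \<and> \<phi> (s, t) = nat (j mod int g)" if "(s, t) \<in> Q" for s t
  proof -
    have "s * int b - t * int a = c" using that by (simp add: Q_def coprime_pairs_def a_def b_def g_def)
    then have eq: "(s - s0) * int b = (t - t0) * int a" using c0 by (simp add: algebra_simps)
    then have "int a dvd (s - s0) * int b" by simp
    moreover have "coprime (int a) (int b)" using cab by simp
    ultimately have "int a dvd s - s0" by (simp add: coprime_dvd_mult_left_iff)
    then obtain j where j: "s - s0 = int a * j" by blast
    have "(t - t0) * int a = (int b * j) * int a" using eq unfolding j by (metis mult.assoc mult.commute)
    then have "t - t0 = int b * j" using a0 by simp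
    then show ?thesis using j a0 by (intro exI[of _ j]) (auto simp: \<phi>_def)
  qed
  have inj: "inj_on \<phi> Q"
  proof (rule inj_onI)
    fix u u' assume u: "u \<in> Q" "u' \<in> Q" "\<phi> u = \<phi> u'"
    obtain s t where st: "u = (s, t)" by (cases u)
    obtain s' t' where st': "u' = (s', t')" by (cases u')
    obtain j where j: "s = s0 + int a * j" "t = t0 + int b * j" "\<phi> u = nat (j mod int g)"
      using par u(1) st by blast
    obtain j' where j': "s' = s0 + int a * j'" "t' = t0 + int b * j'" "\<phi> u' = nat (j' mod int g)"
      using par u(2) st' by blast
    have "j mod int g = j' mod int g" using j(3) j'(3) u(3) g0 by (metis nat_int pos_mod_sign nat_eq_iff2 of_nat_0_less_iff)
    then have "int g dvd j - j'" by (simp add: mod_eq_dvd_iff)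
    then have "int m dvd int a * (j - j')" unfolding ma by (simp add: mult_dvd_mono mult.commute)
    then have "int m dvd s - s'" using j j' by (simp add: algebra_simps)
    then have "s mod int m = s' mod int m" by (simp add: mod_eq_dvd_iff)
    moreover have "s \<in> {0..<int m}" "s' \<in> {0..<int m}" using u st st' by (auto simp: Q_def coprime_pairs_def)
    ultimately have "s = s'" by simp
    then have "j = j'" using j j' a0 by simp
    then show "u = u'" using j j' st st' by simp
  qed
  have img: "\<phi> ` Q \<subseteq> J"
  proof
    fix i assume "i \<in> \<phi> ` Q"
    then obtain s t where st: "(s, t) \<in> Q" "i = \<phi> (s, t)" by auto
    obtain j where j: "s = s0 + int a * j" "t = t0 + int b * j" "i = nat (j mod int g)"
      using par[OF st(1)] st(2) by blast
    have ig: "i < g" using j(3) g0 by (simp add: nat_less_iff)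
    have ii: "int i = j mod int g" using j(3) g0 by simp
    have "f p (i mod p) = 1" if p: "p \<in> prime_factors g" for p
    proof -
      have "int (i mod p) mod int p = j mod int p"
        using pf[OF p] by (simp add: zmod_int ii mod_mod_cancel)
      then have d: "int p dvd int (i mod p) - j" by (simp add: mod_eq_dvd_iff)
      have "\<not> int p dvd s" "\<not> int p dvd t"
      proof -
        have "coprime s (int m)" "coprime t (int n)" using st by (auto simp: Q_def coprime_pairs_def)
        moreover have "int p dvd int m" "int p dvd int n" using pf[OF p] by (auto simp: ma nb)
        moreover have "\<not> is_unit (int p)" using pf[OF p] by auto
        ultimately show "\<not> int p dvd s" "\<not> int p dvd t" by (meson coprime_common_divisor)+
      qed
      moreover have "s0 + int a * int (i mod p) = s + int a * (int (i mod p) - j)"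
        "t0 + int b * int (i mod p) = t + int b * (int (i mod p) - j)"
        using j by (simp_all add: algebra_simps)
      ultimately show ?thesis using d unfolding f_def by (simp add: dvd_add_left_iff)
    qed
    then show "i \<in> J" using ig by (simp add: J_def)
  qed
  have fJ: "finite J" by (simp add: J_def)
  have "card Q = card (\<phi> ` Q)" using inj by (simp add: card_image)
  also have "\<dots> \<le> card J" using img fJ by (rule card_mono[rotated])
  finally have "real (card Q) \<le> real (card J)" by simp
  also have "\<dots> = (\<Sum>j\<in>J. 1)" by simp
  also have "\<dots> = (\<Sum>j\<in>J. \<Prod>p\<in>prime_factors g. f p (j mod p))"
    by (intro sum.cong refl) (simp add: J_def)
  also have "\<dots> \<le> (\<Sum>j<g. \<Prod>p\<in>prime_factors g. f p (j mod p))"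
    by (intro sum_mono2) (auto simp: J_def f_def intro!: prod_nonneg)
  also have "\<dots> = real g * (\<Prod>p\<in>prime_factors g. (\<Sum>r<p. f p r) / real p)"
  proof (rule sum_prod_mod_primes)
    show "\<Prod>(prime_factors g) dvd g" using g0 by (rule prod_prime_factors_dvd)
  qed (use pf in auto)
  also have "\<dots> \<le> real g * (\<Prod>p\<in>prime_factors g. (1 - 1 / real p) *
      (if \<not> int p dvd int (a * b) * c then 1 - 1 / real p else 1))"
  proof (intro mult_left_mono prod_mono conjI)
    fix p assume p: "p \<in> prime_factors g"
    have prime: "prime p" and p2: "p \<ge> 2" using pf[OF p] prime_ge_2_nat by auto
    show "0 \<le> (\<Sum>r<p. f p r) / real p" by (simp add: f_def sum_nonneg)
    define Bad where "Bad = {r \<in> {..<p}. int p dvd s0 + int a * int r \<or> int p dvd t0 + int b * int r}"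
    have fB: "finite Bad" by (simp add: Bad_def)
    have "(\<Sum>r<p. f p r) = (\<Sum>r\<in>{..<p} - Bad. 1)"
      by (intro sum.mono_neutral_cong_right) (auto simp: f_def Bad_def)
    also have "\<dots> = real p - real (card Bad)"
    proof -
      have BS: "Bad \<subseteq> {..<p}" by (auto simp: Bad_def)
      then have "card Bad \<le> p" using card_mono[OF _ BS] by simp
      then show ?thesis using card_Diff_subset[OF fB BS] by (simp add: of_nat_diff)
    qed
    finally have eq: "(\<Sum>r<p. f p r) = real p - real (card Bad)" .
    show "(\<Sum>r<p. f p r) / real p \<le> (1 - 1 / real p) *
      (if \<not> int p dvd int (a * b) * c then 1 - 1 / real p else 1)"
    proof (cases "int p dvd int (a * b) * c")
      case False
      then have nd: "\<not> int p dvd int a" "\<not> int p dvd int b" "\<not> int p dvd c" by auto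
      obtain r1 where r1: "r1 < p" "int p dvd s0 + int a * int r1" using linear_congruence_solution[OF prime nd(1)] .
      obtain r2 where r2: "r2 < p" "int p dvd t0 + int b * int r2" using linear_congruence_solution[OF prime nd(2)] .
      \<comment> \<open>At a common root \<open>p\<close> would divide both coordinates of a point
        on the line, hence also the combination \<open>c\<close>.\<close>
      have "r1 \<noteq> r2"
      proof
        assume "r1 = r2"
        then have "int p dvd (s0 + int a * int r1) * int b - (t0 + int b * int r1) * int a"
          using r1 r2 by (intro dvd_diff dvd_mult2) auto
        also have "(s0 + int a * int r1) * int b - (t0 + int b * int r1) * int a = c"
          using c0 by (simp add: algebra_simps)
        finally show False using nd by simp
      qed
      moreover have "{r1, r2} \<subseteq> Bad" using r1 r2 by (simp add: Bad_def)
      ultimately have "card Bad \<ge> 2" using card_mono[OF fB, of "{r1, r2}"] by simp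
      then have "(\<Sum>r<p. f p r) / real p \<le> (real p - 2) / real p"
        unfolding eq by (intro divide_right_mono) auto
      also have "\<dots> \<le> (1 - 1 / real p) * (1 - 1 / real p)"
        using p2 by (simp add: field_simps)
      finally show ?thesis using False by simp
    next
      case True
      \<comment> \<open>At least one of the two linear conditions is not constant modulo
        \<open>p\<close>, so it excludes a residue.\<close>
      have "\<not> (p dvd a \<and> p dvd b)" using cab prime by (meson coprime_common_divisor not_prime_unit)
      then have "\<exists>r. r \<in> Bad"
      proof (cases "p dvd a")
        case True
        then have "\<not> int p dvd int b" using \<open>\<not> (p dvd a \<and> p dvd b)\<close> by simp
        from linear_congruence_solution[OF prime this] show ?thesis by (metis (mono_tags, lifting) Bad_def lessThan_iff mem_Collect_eq)
      next
        case False
        then have "\<not> int p dvd int a" by simp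
        from linear_congruence_solution[OF prime this] show ?thesis by (metis (mono_tags, lifting) Bad_def lessThan_iff mem_Collect_eq)
      qed
      then have "card Bad > 0" using fB by (auto simp: card_gt_0_iff)
      then have "(\<Sum>r<p. f p r) / real p \<le> (real p - 1) / real p"
        unfolding eq by (intro divide_right_mono) auto
      then show ?thesis using True p2 by (simp add: diff_divide_distrib)
    qed
  qed simp
  also have "\<dots> = real g * totient_ratio g *
     (\<Prod>p\<in>{p \<in> prime_factors g. \<not> int p dvd int (a * b) * c}. 1 - 1 / real p)"
    by (subst prod.inter_filter) (simp_all add: prod.distrib totient_ratio_prod[OF g0])
  finally show ?thesis by (simp add: Q_def)
qed

text \<open>Compare the multiplicity of \<open>1 - 1 / p\<close> for each prime. If
  \<open>p dvd g\<close> it is two on both sides, the second occurrence on the right coming from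
  \<open>a * b\<close> or from the last product. A prime outside \<open>g\<close> divides at most
  one of the coprime numbers \<open>a\<close> and \<open>b\<close>, and so occurs at most
  once.\<close>

lemma totient_ratio_gcd_decomp:
  assumes m: "m > 0" and n: "n > 0"
  defines "g \<equiv> gcd m n"
  defines "a \<equiv> m div g" and "b \<equiv> n div g"
  shows "totient_ratio m * totient_ratio n = totient_ratio g * totient_ratio (a * b) *
     (\<Prod>p\<in>{p \<in> prime_factors g. \<not> p dvd a * b}. 1 - 1 / real p)"
proof -
  define u where "u = (\<lambda>p::nat. 1 - 1 / real p)"
  have g0: "g > 0" using m by (simp add: g_def)
  have ma: "m = g * a" and nb: "n = g * b" by (simp_all add: a_def b_def g_def)
  have cab: "coprime a b" unfolding a_def b_def g_def using m by (intro div_gcd_coprime) simp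
  have a0: "a > 0" and b0: "b > 0" using m n ma nb by (auto intro: Nat.gr0I)
  define G where "G = prime_factors g"
  define A where "A = prime_factors a"
  define B where "B = prime_factors b"
  have fin: "finite G" "finite A" "finite B" by (simp_all add: G_def A_def B_def)
  have dis: "A \<inter> B = {}"
    using cab unfolding A_def B_def disjoint_iff in_prime_factors_iff
    by (meson coprime_common_divisor not_prime_unit)
  have m_eq: "totient_ratio m = prod u G * prod u (A - G)"
  proof -
    have "prime_factors m = G \<union> (A - G)"
      using ma g0 a0 by (auto simp: prime_factors_product G_def A_def)
    then have "totient_ratio m = prod u (G \<union> (A - G))"
      unfolding totient_ratio_prod[OF m] u_def by simp
    also have "\<dots> = prod u G * prod u (A - G)" using fin by (intro prod.union_disjoint) auto
    finally show ?thesis .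
  qed
  have n_eq: "totient_ratio n = prod u G * prod u (B - G)"
  proof -
    have "prime_factors n = G \<union> (B - G)"
      using nb g0 b0 by (auto simp: prime_factors_product G_def B_def)
    then have "totient_ratio n = prod u (G \<union> (B - G))"
      unfolding totient_ratio_prod[OF n] u_def by simp
    also have "\<dots> = prod u G * prod u (B - G)" using fin by (intro prod.union_disjoint) auto
    finally show ?thesis .
  qed
  have g_eq: "totient_ratio g = prod u G" using g0 by (simp add: totient_ratio_prod G_def u_def)
  have ab_eq: "totient_ratio (a * b) = prod u (A \<union> B)"
    using a0 b0 by (simp add: totient_ratio_prod A_def B_def u_def prime_factors_product)
  have set_eq: "{p \<in> prime_factors g. \<not> p dvd a * b} = G - (A \<union> B)"
    using a0 b0 by (auto simp: G_def A_def B_def in_prime_factors_iff prime_dvd_mult_iff)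
  have "prod u (A \<union> B) * prod u (G - (A \<union> B)) = prod u (A \<union> B \<union> (G - (A \<union> B)))"
    using fin by (intro prod.union_disjoint[symmetric]) auto
  also have "A \<union> B \<union> (G - (A \<union> B)) = G \<union> ((A - G) \<union> (B - G))" by auto
  also have "prod u \<dots> = prod u G * (prod u (A - G) * prod u (B - G))"
    using fin dis by (subst prod.union_disjoint; (subst prod.union_disjoint)?) auto
  finally show ?thesis
    unfolding m_eq n_eq g_eq ab_eq set_eq u_def[symmetric] by (simp add: mult_ac)
qed

section \<open>Approximation sets, their measure and their intersections\<close>

definition approx_set :: "nat \<Rightarrow> real \<Rightarrow> real set" where
  "approx_set n \<delta> = {x \<in> {0..1}. \<exists>m::int. coprime (int n) m \<and> \<bar>x * real n - real_of_int m\<bar> < \<delta>}"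

lemma approx_set_borel: "approx_set n \<delta> \<in> sets borel"
proof -
  have "approx_set n \<delta> = {0..1} \<inter> (\<Union>m\<in>{m::int. coprime (int n) m}. {x. \<bar>x * real n - real_of_int m\<bar> < \<delta>})"
    by (auto simp: approx_set_def)
  moreover have "open (\<Union>m\<in>{m::int. coprime (int n) m}. {x. \<bar>x * real n - real_of_int m\<bar> < \<delta>})"
    by (intro open_UN ballI open_Collect_less continuous_intros)
  ultimately show ?thesis by auto
qed

lemma approx_set_lmeasurable: "approx_set n \<delta> \<in> lmeasurable"
proof (rule bounded_set_imp_lmeasurable)
  show "bounded (approx_set n \<delta>)"
    by (rule bounded_subset[of "{0..1}"]) (auto simp: approx_set_def)
  show "approx_set n \<delta> \<in> sets lebesgue"
    using approx_set_borel by simp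
qed

lemma approx_set_mono: "\<delta> \<le> \<delta>' \<Longrightarrow> approx_set n \<delta> \<subseteq> approx_set n \<delta>'"
  by (force simp: approx_set_def)

text \<open>The bound on \<delta> confines \<open>s\<close> to \<open>0..n\<close>, and for
  \<open>n \<ge> 2\<close> coprimality rules out the right end \<open>s = n\<close>.\<close>

lemma approx_setE:
  assumes "x \<in> approx_set n \<delta>" "n \<ge> 2" "\<delta> \<le> 1 / 2"
  obtains s where "s \<in> {0..<int n}" "coprime s (int n)" "\<bar>x * real n - real_of_int s\<bar> < \<delta>"
proof -
  obtain s where s: "coprime (int n) s" "\<bar>x * real n - real_of_int s\<bar> < \<delta>" and x: "0 \<le> x" "x \<le> 1"
    using assms(1) by (auto simp: approx_set_def)
  have "0 \<le> x * real n" "x * real n \<le> real n" using x by (auto simp: mult_left_le_one_le)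
  then have "real_of_int s > -1" "real_of_int s < real n + 1" using s(2) assms(3) by linarith+
  then have "s \<ge> 0" "s \<le> int n" by linarith+
  moreover have "s \<noteq> int n"
  proof
    assume "s = int n"
    then show False using s(1) assms(2) by auto
  qed
  ultimately have "s \<in> {0..<int n}" by auto
  then show thesis using that s by (auto simp: coprime_commute)
qed

lemma Icc_lmeasurable [simp]: "{a..b::real} \<in> lmeasurable"
  by (metis interval_cbox lmeasurable_cbox)

lemma measure_approx_set_le:
  assumes n: "n \<ge> 2" and \<delta>: "0 < \<delta>" "\<delta> \<le> 1 / 2"
  shows "measure lebesgue (approx_set n \<delta>) \<le> 2 * \<delta> * totient_ratio n"
proof -
  define I where "I = (\<lambda>s::nat. {(real s - \<delta>) / real n..(real s + \<delta>) / real n})"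
  have "approx_set n \<delta> \<subseteq> (\<Union>s\<in>totatives n. I s)"
  proof
    fix x assume "x \<in> approx_set n \<delta>"
    then obtain s where s: "s \<in> {0..<int n}" "coprime s (int n)" "\<bar>x * real n - real_of_int s\<bar> < \<delta>"
      using approx_setE[OF _ n \<delta>(2)] by blast
    obtain k where k: "s = int k" using s(1) by (metis atLeastLessThan_iff nonneg_int_cases)
    have "k \<noteq> 0"
      using s(2) n k by (auto intro!: Nat.gr0I)
    then have "k \<in> totatives n" using s k by (auto simp: in_totatives_iff)
    moreover have "x \<in> I k" using s(3) k n by (auto simp: I_def field_simps abs_less_iff)
    ultimately show "x \<in> (\<Union>s\<in>totatives n. I s)" by blast
  qed
  then have "measure lebesgue (approx_set n \<delta>) \<le> measure lebesgue (\<Union>s\<in>totatives n. I s)"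
    using approx_set_lmeasurable
    by (intro measure_mono_fmeasurable fmeasurable.finite_UN) (auto simp: I_def fmeasurableD)
  also have "\<dots> \<le> (\<Sum>s\<in>totatives n. measure lebesgue (I s))"
    by (rule measure_UNION_le) (auto simp: I_def)
  also have "\<dots> = (\<Sum>s\<in>totatives n. 2 * \<delta> / real n)"
    using \<delta> n by (intro sum.cong refl) (simp add: I_def divide_right_mono, simp add: field_simps)
  also have "\<dots> = 2 * \<delta> * totient_ratio n"
    by (simp add: totient_ratio_def totient_def)
  finally show ?thesis .
qed

text \<open>Modulo \<open>a\<close> the number \<open>c\<close> is \<open>s * b\<close>, and modulo
  \<open>b\<close> it is \<open>- t * a\<close>; both are units. Hence \<open>c = 0\<close> would
  force \<open>a * b = 1\<close> and \<open>m = n\<close>, so distinct denominators leave no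
  diagonal term. The size follows from
  \<open>g * c = m * (x * n - t) - n * (x * m - s)\<close>.\<close>

lemma overlap_numerator:
  fixes s t :: int
  assumes m: "m \<ge> 2" and n: "n \<ge> 2" and "m \<noteq> n"
  defines "g \<equiv> gcd m n"
  defines "a \<equiv> m div g" and "b \<equiv> n div g"
  assumes s: "coprime s (int m)" "\<bar>x * real m - real_of_int s\<bar> < \<delta>"
    and t: "coprime t (int n)" "\<bar>x * real n - real_of_int t\<bar> < \<delta>"
  defines "c \<equiv> s * int b - t * int a"
  shows "c \<noteq> 0" "coprime c (int (a * b))" "real_of_int \<bar>c\<bar> \<le> 2 * (\<delta> * real (max a b))"
proof -
  have g0: "g > 0" using m by (simp add: g_def)
  have ma: "m = g * a" and nb: "n = g * b" by (simp_all add: a_def b_def g_def)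
  have cab: "coprime (int a) (int b)"
    unfolding a_def b_def g_def using m by (simp only: coprime_int_iff) (intro div_gcd_coprime, simp)
  have sa: "coprime s (int a)" using s(1) by (simp add: ma)
  have tb: "coprime t (int b)" using t(1) by (simp add: nb)
  have ca: "coprime c (int a)"
  proof -
    have "coprime (s * int b) (int a)" using sa cab by (simp add: coprime_commute)
    moreover have "gcd c (int a) = gcd (s * int b) (int a)"
      using gcd_add_mult[of "int a" "- t" "s * int b"] by (simp add: c_def gcd.commute algebra_simps)
    ultimately show ?thesis by (simp add: coprime_iff_gcd_eq_1)
  qed
  have cb: "coprime c (int b)"
  proof -
    have "coprime (t * int a) (int b)" using tb cab by simp
    moreover have "gcd c (int b) = gcd (- (t * int a)) (int b)"
      using gcd_add_mult[of "int b" s "- (t * int a)"] by (simp add: c_def gcd.commute algebra_simps)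
    ultimately show ?thesis by (simp add: coprime_iff_gcd_eq_1)
  qed
  show cop: "coprime c (int (a * b))" using ca cb by simp
  show "c \<noteq> 0"
  proof
    assume "c = 0"
    then have "a * b = 1" using cop by (simp del: of_nat_mult)
    then show False using ma nb \<open>m \<noteq> n\<close> by simp
  qed
  have "real g * real_of_int c = real_of_int s * real n - real_of_int t * real m"
    by (simp add: c_def ma nb algebra_simps)
  also have "\<dots> = real m * (x * real n - real_of_int t) - real n * (x * real m - real_of_int s)"
    by (simp add: algebra_simps)
  also have "\<bar>\<dots>\<bar> \<le> real m * \<bar>x * real n - real_of_int t\<bar> + real n * \<bar>x * real m - real_of_int s\<bar>"
    by (rule order_trans[OF abs_triangle_ineq4]) (simp add: abs_mult)
  also have "\<dots> \<le> real m * \<delta> + real n * \<delta>"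
    using s t by (intro add_mono mult_left_mono) auto
  also have "\<dots> \<le> real (max m n) * \<delta> + real (max m n) * \<delta>"
    using s(2) by (intro add_mono mult_right_mono) auto
  also have "real (max m n) = real g * real (max a b)" unfolding ma nb by (simp flip: nat_mult_max_right)
  finally have "real g * \<bar>real_of_int c\<bar> \<le> real g * (2 * (\<delta> * real (max a b)))"
    by (simp add: abs_mult algebra_simps)
  then show "real_of_int \<bar>c\<bar> \<le> 2 * (\<delta> * real (max a b))" using g0 by simp
qed

text \<open>Every point of the overlap belongs to a pair \<open>(s, t)\<close> with some admissible
  \<open>c\<close>, and the overlap for that pair lies in an interval of length
  \<open>2 * \<delta> / max m n\<close>. The 4 combines this 2 with the two signs of
  \<open>c\<close>.\<close>

lemma measure_overlap_le:
  assumes m: "m \<ge> 2" and n: "n \<ge> 2" and "m \<noteq> n" and \<delta>: "0 < \<delta>" "\<delta> \<le> 1 / 2"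
  defines "g \<equiv> gcd m n"
  defines "a \<equiv> m div g" and "b \<equiv> n div g"
  defines "D \<equiv> \<delta> * real (max a b)"
  shows "measure lebesgue (approx_set m \<delta> \<inter> approx_set n \<delta>) \<le> 4 * \<delta>\<^sup>2 * totient_ratio m * totient_ratio n *
     ((\<Sum>c\<in>{c \<in> {1..nat \<lfloor>2 * D\<rfloor>}. coprime c (a * b)}. 1 / totient_ratio c) / (D * totient_ratio (a * b)))"
proof -
  have g0: "g > 0" using m by (simp add: g_def)
  have ma: "m = g * a" and nb: "n = g * b" by (simp_all add: a_def b_def g_def)
  have a0: "a > 0" and b0: "b > 0" using m n ma nb by (auto intro: Nat.gr0I)
  define Z where "Z = nat \<lfloor>2 * D\<rfloor>"
  define P where "P = {c \<in> {1..Z}. coprime c (a * b)}"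
  define CC where "CC = int ` P \<union> (\<lambda>c. - int c) ` P"
  define N where "N = max m n"
  define E where "E = (\<Prod>p\<in>{p \<in> prime_factors g. \<not> p dvd a * b}. 1 - 1 / real p)"
  have fP: "finite P" by (simp add: P_def)
  define pairs where "pairs = (\<Union>c\<in>CC. coprime_pairs m n c)"
  \<comment> \<open>The interval around the fraction with the larger denominator is the shorter
    one.\<close>
  define I where "I = (\<lambda>(s, t). if n \<le> m then {(real_of_int s - \<delta>) / real m..(real_of_int s + \<delta>) / real m}
    else {(real_of_int t - \<delta>) / real n..(real_of_int t + \<delta>) / real n})"
  have fc: "finite (coprime_pairs m n c)" for c
    by (rule finite_subset[of _ "{0..<int m} \<times> {0..<int n}"]) (auto simp: coprime_pairs_def)
  have fCC: "finite CC" using fP by (simp add: CC_def)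
  have fpairs: "finite pairs" using fCC fc by (simp add: pairs_def)
  have Ilm: "I u \<in> lmeasurable" for u by (auto simp: I_def split: prod.splits)
  have Imeas: "measure lebesgue (I u) = 2 * \<delta> / real N" for u
  proof -
    obtain s t where u: "u = (s, t)" by (cases u)
    define x where "x = (if n \<le> m then real_of_int s else real_of_int t)"
    have "I u = {(x - \<delta>) / real N..(x + \<delta>) / real N}" by (simp add: u I_def N_def x_def)
    then show ?thesis using \<delta> by (simp add: divide_right_mono) (simp add: diff_divide_distrib add_divide_distrib)
  qed
  have "approx_set m \<delta> \<inter> approx_set n \<delta> \<subseteq> (\<Union>u\<in>pairs. I u)"
  proof
    fix x assume x: "x \<in> approx_set m \<delta> \<inter> approx_set n \<delta>"
    obtain s where s: "s \<in> {0..<int m}" "coprime s (int m)" "\<bar>x * real m - real_of_int s\<bar> < \<delta>"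
      using approx_setE[OF _ m \<delta>(2)] x by blast
    obtain t where t: "t \<in> {0..<int n}" "coprime t (int n)" "\<bar>x * real n - real_of_int t\<bar> < \<delta>"
      using approx_setE[OF _ n \<delta>(2)] x by blast
    define c where "c = s * int b - t * int a"
    note c = overlap_numerator[OF m n \<open>m \<noteq> n\<close> s(2,3) t(2,3), folded g_def, folded a_def b_def, folded c_def D_def]
    have "nat \<bar>c\<bar> \<in> P"
    proof -
      have "\<bar>c\<bar> \<le> \<lfloor>2 * D\<rfloor>" using c(3) by (simp add: le_floor_iff)
      then have "nat \<bar>c\<bar> \<le> Z" unfolding Z_def by (rule nat_mono)
      moreover have "1 \<le> nat \<bar>c\<bar>" using c(1) by linarith
      moreover have "coprime (nat \<bar>c\<bar>) (a * b)"
      proof -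
        have "coprime (int (nat \<bar>c\<bar>)) (int (a * b))" using c(2) by simp
        then show ?thesis by (simp only: coprime_int_iff)
      qed
      ultimately show ?thesis by (simp add: P_def)
    qed
    then have "c \<in> CC"
    proof (cases "c \<ge> 0")
      case True
      then have "c = int (nat \<bar>c\<bar>)" by simp
      then show ?thesis using \<open>nat \<bar>c\<bar> \<in> P\<close> unfolding CC_def by blast
    next
      case False
      then have "c = - int (nat \<bar>c\<bar>)" by simp
      then show ?thesis using \<open>nat \<bar>c\<bar> \<in> P\<close> unfolding CC_def by blast
    qed
    moreover have "(s, t) \<in> coprime_pairs m n c"
      using s t by (simp add: coprime_pairs_def c_def a_def b_def g_def)
    ultimately have "(s, t) \<in> pairs" by (auto simp: pairs_def)
    moreover have "x \<in> I (s, t)"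
      using s(3) t(3) m n by (auto simp: I_def field_simps abs_less_iff)
    ultimately show "x \<in> (\<Union>u\<in>pairs. I u)" by blast
  qed
  then have "measure lebesgue (approx_set m \<delta> \<inter> approx_set n \<delta>) \<le> measure lebesgue (\<Union>u\<in>pairs. I u)"
    using fpairs Ilm approx_set_lmeasurable[THEN fmeasurableD]
    by (intro measure_mono_fmeasurable fmeasurable.finite_UN) auto
  also have "\<dots> \<le> (\<Sum>u\<in>pairs. measure lebesgue (I u))"
    using fpairs Ilm by (intro measure_UNION_le) (auto intro: fmeasurableD)
  also have "\<dots> = real (card pairs) * (2 * \<delta> / real N)" by (simp add: Imeas)
  also have "\<dots> \<le> 2 * (\<Sum>c\<in>P. real g * totient_ratio g * (E / totient_ratio c)) * (2 * \<delta> / real N)"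
  proof (rule mult_right_mono)
    \<comment> \<open>The primes of \<open>g\<close> that divide \<open>c\<close> but not
      \<open>a * b\<close> are missing from the local product. Restoring them costs at most
      \<open>1 / totient_ratio c\<close>, and what remains is the product \<open>E\<close>,
      independent of \<open>c\<close>.\<close>
    have bound: "real (card (coprime_pairs m n c)) \<le> real g * totient_ratio g * (E / totient_ratio k)"
      if k: "k \<in> P" "c = int k \<or> c = - int k" for c k
    proof -
      have k0: "k > 0" using k by (simp add: P_def)
      define u where "u = (\<lambda>p::nat. 1 - 1 / real p)"
      have u01: "0 < u p \<and> u p \<le> 1" if "prime p" for p
        using prime_gt_1_nat[OF that] by (simp add: u_def field_simps)
      define S where "S = {p \<in> prime_factors g. \<not> p dvd a * b}"
      define T where "T = {p \<in> S. p dvd k}"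
      have fS: "finite S" unfolding S_def by (rule finite_subset[of _ "prime_factors g"]) auto
      have pS: "prime p" if "p \<in> S" for p using that by (auto simp: S_def)
      have dv: "int p dvd int (a * b) * c \<longleftrightarrow> p dvd a * b \<or> p dvd k" if "prime p" for p
      proof -
        have "int p dvd int (a * b) * c \<longleftrightarrow> int p dvd int (a * b) * int k"
          using k(2) by auto
        also have "\<dots> \<longleftrightarrow> p dvd a * b * k" by (simp flip: of_nat_mult)
        finally show ?thesis using that by (simp add: prime_dvd_mult_iff)
      qed
      have set_eq: "{p \<in> prime_factors g. \<not> int p dvd int (a * b) * c} = S - T"
        using dv by (auto simp: S_def T_def in_prime_factors_iff)
      have "totient_ratio k = prod u (prime_factors k)" using k0 by (simp add: totient_ratio_prod u_def)
      also have "prime_factors k = T \<union> (prime_factors k - T)"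
        using k0 by (auto simp: T_def S_def in_prime_factors_iff)
      also have "prod u \<dots> = prod u T * prod u (prime_factors k - T)"
        using fS by (intro prod.union_disjoint) (auto simp: T_def)
      also have "\<dots> \<le> prod u T * 1"
        using u01 pS by (intro mult_left_mono prod_nonneg prod_le_1)
          (auto simp: T_def in_prime_factors_iff less_imp_le)
      finally have kT: "totient_ratio k \<le> prod u T" by simp
      have "prod u S = prod u T * prod u (S - T)"
        using fS by (subst prod.union_disjoint[symmetric]) (auto simp: T_def intro!: prod.cong)
      then have "prod u (S - T) * prod u T = E" by (simp add: E_def S_def u_def mult.commute)
      moreover have "prod u (S - T) * totient_ratio k \<le> prod u (S - T) * prod u T"
        using kT u01 pS by (intro mult_left_mono prod_nonneg) (auto simp: less_imp_le)
      ultimately have "prod u (S - T) \<le> E / totient_ratio k"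
        using totient_ratio_pos[OF k0] by (simp add: field_simps)
      moreover have "real (card (coprime_pairs m n c)) \<le> real g * totient_ratio g * prod u (S - T)"
        using card_coprime_pairs_le[of m n c, folded g_def, folded a_def b_def] m n set_eq
        by (simp add: u_def)
      ultimately show ?thesis
        using totient_ratio_pos[OF g0] by (meson less_imp_le mult_left_mono mult_nonneg_nonneg of_nat_0_le_iff order_trans)
    qed
    have "card pairs \<le> (\<Sum>c\<in>CC. card (coprime_pairs m n c))"
      unfolding pairs_def using fCC by (rule card_UN_le)
    then have "real (card pairs) \<le> (\<Sum>c\<in>CC. real (card (coprime_pairs m n c)))"
      by (metis of_nat_le_iff of_nat_sum)
    also have "\<dots> \<le> (\<Sum>c\<in>int ` P. real (card (coprime_pairs m n c))) + (\<Sum>c\<in>(\<lambda>c. - int c) ` P. real (card (coprime_pairs m n c)))"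
      unfolding CC_def using fP by (subst sum.union_inter[symmetric]) (auto intro!: sum_nonneg)
    also have "\<dots> = (\<Sum>c\<in>P. real (card (coprime_pairs m n (int c)))) + (\<Sum>c\<in>P. real (card (coprime_pairs m n (- int c))))"
      by (subst (1 2) sum.reindex) (auto simp: inj_on_def)
    also have "\<dots> \<le> (\<Sum>c\<in>P. real g * totient_ratio g * (E / totient_ratio c)) + (\<Sum>c\<in>P. real g * totient_ratio g * (E / totient_ratio c))"
      using bound by (intro add_mono sum_mono) auto
    finally show "real (card pairs) \<le> 2 * (\<Sum>c\<in>P. real g * totient_ratio g * (E / totient_ratio c))" by simp
  qed (use \<delta> in simp)
  also have "2 * (\<Sum>c\<in>P. real g * totient_ratio g * (E / totient_ratio c)) * (2 * \<delta> / real N)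
    = 4 * \<delta> * (real g / real N) * (totient_ratio g * E) * (\<Sum>c\<in>P. 1 / totient_ratio c)"
    by (simp add: sum_distrib_left sum_divide_distrib mult_ac)
  also have "real g / real N = \<delta> / D"
  proof -
    have "real N = real g * real (max a b)" unfolding N_def ma nb by (simp flip: nat_mult_max_right)
    then show ?thesis using g0 \<delta> a0 by (simp add: D_def)
  qed
  also have "totient_ratio g * E = totient_ratio m * totient_ratio n / totient_ratio (a * b)"
  proof -
    have "totient_ratio m * totient_ratio n = totient_ratio g * totient_ratio (a * b) * E"
      using totient_ratio_gcd_decomp[of m n, folded g_def, folded a_def b_def] m n by (simp add: E_def)
    moreover have "totient_ratio (a * b) > 0" using a0 b0 by (intro totient_ratio_pos) simp
    ultimately show ?thesis by (simp add: field_simps)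
  qed
  finally show ?thesis
    by (simp add: P_def Z_def power2_eq_square mult_ac)
qed

subsection \<open>Equidistribution on intervals\<close>

text \<open>The Legendre sieve by induction: the multiples of \<open>q\<close> in the sifted set are
  \<open>q\<close> times the sifted set of the interval shrunk by \<open>q\<close>, so a new prime
  subtracts two instances and doubles the error.\<close>

lemma card_sifted_interval:
  fixes A B :: real
  assumes "finite F" "\<And>p. p \<in> F \<Longrightarrow> prime p" "A \<le> B"
  shows "\<bar>real (card {k::int. A < of_int k \<and> of_int k \<le> B \<and> (\<forall>p\<in>F. \<not> int p dvd k)})
     - (B - A) * (\<Prod>p\<in>F. 1 - 1 / real p)\<bar> \<le> 2 ^ card F"
  using assms
proof (induction F arbitrary: A B rule: finite_induct)
  case empty
  have "{k::int. A < of_int k \<and> of_int k \<le> B} = {\<lfloor>A\<rfloor><..\<lfloor>B\<rfloor>}"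
    by (auto simp: floor_less_iff le_floor_iff)
  moreover have "\<lfloor>A\<rfloor> \<le> \<lfloor>B\<rfloor>" using empty.prems by (intro floor_mono)
  ultimately have "real (card {k::int. A < of_int k \<and> of_int k \<le> B}) = of_int \<lfloor>B\<rfloor> - of_int \<lfloor>A\<rfloor>"
    by simp
  then show ?case by simp linarith
next
  case (insert q F)
  define S where "S = (\<lambda>A B. {k::int. (A::real) < of_int k \<and> of_int k \<le> (B::real) \<and> (\<forall>p\<in>F. \<not> int p dvd k)})"
  define \<rho> where "\<rho> = (\<Prod>p\<in>F. 1 - 1 / real p)"
  have q: "prime q" and F: "\<And>p. p \<in> F \<Longrightarrow> prime p" using insert.prems by auto
  have q0: "real q > 0" using prime_gt_0_nat[OF q] by simp
  have fS: "finite (S A B)" for A B :: real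
  proof (rule finite_subset)
    show "S A B \<subseteq> {\<lfloor>A\<rfloor>..\<lfloor>B\<rfloor>}" by (auto simp: S_def le_floor_iff floor_le_iff)
  qed simp
  have IH: "\<bar>real (card (S A B)) - (B - A) * \<rho>\<bar> \<le> 2 ^ card F" if "A \<le> B" for A B
    using insert.IH[OF F that] by (simp add: S_def \<rho>_def)
  have mult: "(\<lambda>k. int q * k) ` S (A / q) (B / q) = {k \<in> S A B. int q dvd k}"
  proof (intro equalityI subsetI)
    fix k assume "k \<in> (\<lambda>k. int q * k) ` S (A / q) (B / q)"
    then obtain l where l: "k = int q * l" "l \<in> S (A / q) (B / q)" by blast
    have "\<not> int p dvd k" if "p \<in> F" for p
    proof
      assume "int p dvd k"
      then have "int p dvd int q \<or> int p dvd l"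
        using F[OF that] unfolding l(1) by (simp add: prime_dvd_mult_iff)
      moreover have "\<not> int p dvd l" using l(2) that by (simp add: S_def)
      ultimately have "p dvd q" by simp
      then have "p = q" using F[OF that] q by (simp add: primes_dvd_imp_eq)
      then show False using that insert.hyps by simp
    qed
    then show "k \<in> {k \<in> S A B. int q dvd k}"
      using l q0 by (simp add: S_def field_simps)
  next
    fix k assume k: "k \<in> {k \<in> S A B. int q dvd k}"
    then obtain l where l: "k = int q * l" by auto
    have "l \<in> S (A / q) (B / q)" using k q0 by (auto simp: S_def l field_simps)
    then show "k \<in> (\<lambda>k. int q * k) ` S (A / q) (B / q)" using l by blast
  qed
  have "card {k \<in> S A B. int q dvd k} = card (S (A / q) (B / q))"
    unfolding mult[symmetric] using q0 by (intro card_image) (auto simp: inj_on_def)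
  moreover have "{k::int. A < of_int k \<and> of_int k \<le> B \<and> (\<forall>p\<in>insert q F. \<not> int p dvd k)} = S A B - {k \<in> S A B. int q dvd k}"
    by (auto simp: S_def)
  moreover have "card (S A B - {k \<in> S A B. int q dvd k}) = card (S A B) - card {k \<in> S A B. int q dvd k}"
    by (rule card_Diff_subset) (auto intro: finite_subset[OF _ fS])
  moreover have "card {k \<in> S A B. int q dvd k} \<le> card (S A B)"
    by (rule card_mono[OF fS]) auto
  ultimately have eq: "real (card {k::int. A < of_int k \<and> of_int k \<le> B \<and> (\<forall>p\<in>insert q F. \<not> int p dvd k)})
    = real (card (S A B)) - real (card (S (A / q) (B / q)))" by (simp add: of_nat_diff)
  have pr: "(B - A) * (\<Prod>p\<in>insert q F. 1 - 1 / real p) = (B - A) * \<rho> - (B / q - A / q) * \<rho>"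
    using insert.hyps by (simp add: \<rho>_def algebra_simps diff_divide_distrib)
  have "A / q \<le> B / q" using insert.prems q0 by (intro divide_right_mono) auto
  from IH[OF this] IH[OF insert.prems(2)] show ?case
    unfolding eq pr using insert.hyps by simp
qed

text \<open>Legendre's error \<open>2 ^ card F\<close> is small against the main term because of the
  divisor bound. Half of the expected measure is claimed, which leaves room for the error and for
  the boundary.\<close>

lemma measure_approx_set_interval_ge:
  assumes "\<alpha> \<ge> 0" "\<alpha> < \<beta>" "\<beta> \<le> 1"
  obtains n0 where "\<And>n \<delta>. n \<ge> n0 \<Longrightarrow> 0 < \<delta> \<Longrightarrow> \<delta> \<le> 1 / 2 \<Longrightarrow>
    measure lebesgue (approx_set n \<delta> \<inter> {\<alpha>..<\<beta>}) \<ge> \<delta> * totient_ratio n * (\<beta> - \<alpha>)"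
proof -
  obtain C where C: "C \<ge> 1" "\<And>n::nat. n > 0 \<Longrightarrow> real (card {d. d dvd n}) \<le> C * real n powr (1 / 4)"
    using card_divisors_le_powr[of "1 / 4"] by auto
  \<comment> \<open>Ensures \<open>sqrt n * (\<beta> - \<alpha>) / 2 \<ge> 2 + C\<^sup>2\<close>, so
    that trimming the ends (the 2) and the sieve error (the \<open>C\<^sup>2\<close>) use up at most
    half of the main term.\<close>
  define n0 where "n0 = nat \<lceil>((4 + 2 * C\<^sup>2) / (\<beta> - \<alpha>))\<^sup>2\<rceil> + 1"
  show thesis
  proof (rule that[of n0])
    fix n :: nat and \<delta> :: real
    assume n: "n \<ge> n0" and \<delta>: "0 < \<delta>" "\<delta> \<le> 1 / 2"
    have npos: "n > 0" using n by (simp add: n0_def)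
    define r where "r = sqrt (real n)"
    have r1: "r \<ge> 1" using npos by (simp add: r_def)
    have rr: "r * r = real n" by (simp add: r_def)
    have rbig: "r * (\<beta> - \<alpha>) / 2 \<ge> 2 + C\<^sup>2"
    proof -
      have "((4 + 2 * C\<^sup>2) / (\<beta> - \<alpha>))\<^sup>2 \<le> real n" using n unfolding n0_def by linarith
      then have "(4 + 2 * C\<^sup>2) / (\<beta> - \<alpha>) \<le> r" unfolding r_def by (rule real_le_rsqrt)
      then show ?thesis using assms by (simp add: field_simps)
    qed
    have big: "real n * (\<beta> - \<alpha>) / 2 \<ge> 2 + C\<^sup>2 * r"
    proof -
      have "2 + C\<^sup>2 * r \<le> r * (2 + C\<^sup>2)" using r1 by (simp add: algebra_simps)
      also have "\<dots> \<le> r * (r * (\<beta> - \<alpha>) / 2)" using rbig r1 by (intro mult_left_mono) auto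
      also have "\<dots> = real n * (\<beta> - \<alpha>) / 2" by (simp add: rr[symmetric])
      finally show ?thesis .
    qed
    define F where "F = prime_factors n"
    define \<kappa> where "\<kappa> = totient_ratio n"
    have \<kappa>: "\<kappa> > 0" unfolding \<kappa>_def using npos by (rule totient_ratio_pos)
    \<comment> \<open>The main term carries the factor \<kappa>, so the error must carry it too. One
      divisor function bounds the error, a second one pays for \<open>1 \<le> \<kappa> * d\<close>;
      the exponent \<open>1 / 4\<close> makes their product \<open>O(sqrt n)\<close>.\<close>
    have \<omega>: "2 ^ card F \<le> \<kappa> * (C\<^sup>2 * r)"
    proof -
      define d where "d = real (card {d. d dvd n})"
      have "2 ^ card F \<le> d"
        using two_power_card_prime_factors_le[OF npos] unfolding F_def d_def
        by (metis of_nat_le_iff of_nat_numeral of_nat_power)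
      moreover have "1 \<le> \<kappa> * d"
        using inverse_totient_ratio_le_card_divisors[OF npos] \<kappa> by (simp add: \<kappa>_def d_def field_simps)
      moreover have d0: "d \<ge> 0" by (simp add: d_def)
      ultimately have "2 ^ card F \<le> (\<kappa> * d) * d"
        by (metis mult_1 mult_right_mono order_trans)
      also have "\<dots> \<le> (\<kappa> * (C * real n powr (1 / 4))) * (C * real n powr (1 / 4))"
        using C(2)[OF npos] \<kappa> d0 C(1) by (intro mult_mono mult_left_mono) (auto simp: d_def)
      also have "\<dots> = \<kappa> * (C\<^sup>2 * (real n powr (1 / 4) * real n powr (1 / 4)))"
        by (simp add: power2_eq_square)
      also have "real n powr (1 / 4) * real n powr (1 / 4) = r"
        by (simp add: powr_add[symmetric] r_def powr_half_sqrt)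
      finally show ?thesis .
    qed
    \<comment> \<open>A margin of 1 on each side keeps the intervals of radius
      \<open>\<delta> / n\<close> inside.\<close>
    define K where "K = {k::int. \<alpha> * n + 1 < of_int k \<and> of_int k \<le> \<beta> * n - 1 \<and> (\<forall>p\<in>F. \<not> int p dvd k)}"
    have le: "\<alpha> * n + 1 \<le> \<beta> * n - 1"
    proof -
      have "0 \<le> C\<^sup>2 * r" using r1 by simp
      then have "real n * (\<beta> - \<alpha>) / 2 \<ge> 2" using big by linarith
      then show ?thesis by (simp add: algebra_simps)
    qed
    have "real (card K) \<ge> (\<beta> * n - 1 - (\<alpha> * n + 1)) * \<kappa> - 2 ^ card F"
    proof -
      have "\<bar>real (card K) - (\<beta> * n - 1 - (\<alpha> * n + 1)) * (\<Prod>p\<in>F. 1 - 1 / real p)\<bar> \<le> 2 ^ card F"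
        unfolding K_def using le
        by (intro card_sifted_interval) (auto simp: F_def)
      then show ?thesis by (simp only: F_def \<kappa>_def totient_ratio_prod[OF npos])
    qed
    moreover have "(\<beta> * n - 1 - (\<alpha> * n + 1)) * \<kappa> - 2 ^ card F \<ge> real n * (\<beta> - \<alpha>) / 2 * \<kappa>"
    proof -
      have "(2 + C\<^sup>2 * r) * \<kappa> \<le> (real n * (\<beta> - \<alpha>) / 2) * \<kappa>" using big \<kappa> by (intro mult_right_mono) auto
      moreover have "(2 + C\<^sup>2 * r) * \<kappa> = 2 * \<kappa> + \<kappa> * (C\<^sup>2 * r)" by (simp add: algebra_simps)
      moreover have "(\<beta> * n - 1 - (\<alpha> * n + 1)) * \<kappa> = 2 * (real n * (\<beta> - \<alpha>) / 2 * \<kappa>) - 2 * \<kappa>"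
        by (simp add: algebra_simps)
      ultimately show ?thesis using \<omega> by linarith
    qed
    ultimately have cardK: "real (card K) \<ge> real n * (\<beta> - \<alpha>) / 2 * \<kappa>" by linarith
    define I where "I = (\<lambda>k::int. {(real_of_int k - \<delta>) / real n<..<(real_of_int k + \<delta>) / real n})"
    have fK: "finite K"
    proof (rule finite_subset)
      show "K \<subseteq> {\<lfloor>\<alpha> * n + 1\<rfloor>..\<lfloor>\<beta> * n - 1\<rfloor>}" 
        unfolding K_def by (rule subsetI, unfold mem_Collect_eq atLeastAtMost_iff) linarith
    qed simp
    have Ilm: "I k \<in> lmeasurable" for k by (simp add: I_def lmeasurable_open)
    have Imem: "x \<in> I k \<longleftrightarrow> \<bar>x * real n - real_of_int k\<bar> < \<delta>" for x k
      using npos by (auto simp: I_def field_simps abs_less_iff)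
    have sub: "(\<Union>k\<in>K. I k) \<subseteq> approx_set n \<delta> \<inter> {\<alpha>..<\<beta>}"
    proof
      fix x assume "x \<in> (\<Union>k\<in>K. I k)"
      then obtain k where k: "k \<in> K" "\<bar>x * real n - real_of_int k\<bar> < \<delta>" using Imem by blast
      have "coprime (int n) k"
      proof (rule ccontr)
        assume "\<not> coprime (int n) k"
        then have "gcd n (nat \<bar>k\<bar>) \<noteq> 1" by (metis coprime_iff_gcd_eq_1 gcd_int_def int_nat_eq nat_int of_nat_1 abs_of_nat)
        then obtain p where p: "prime p" "p dvd gcd n (nat \<bar>k\<bar>)" using prime_factor_nat by blast
        have "p dvd n" "p dvd nat \<bar>k\<bar>"
          using dvd_trans[OF p(2) gcd_dvd1] dvd_trans[OF p(2) gcd_dvd2] by auto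
        then have "p \<in> F" "int p dvd k" using npos p(1) by (auto simp: F_def in_prime_factors_iff)
        then show False using k(1) by (simp add: K_def)
      qed
      moreover have "\<alpha> * n < x * n" "x * n < \<beta> * n"
        using k \<delta> by (auto simp: K_def)
      then have "\<alpha> < x" "x < \<beta>" using npos by auto
      ultimately show "x \<in> approx_set n \<delta> \<inter> {\<alpha>..<\<beta>}"
        using k(2) assms by (auto simp: approx_set_def)
    qed
    have disj: "pairwise (\<lambda>i j. disjnt (I i) (I j)) K"
    proof (rule pairwiseI)
      fix i j :: int assume ij: "i \<noteq> j"
      show "disjnt (I i) (I j)"
        unfolding disjnt_iff Imem
      proof (intro allI notI)
        fix x assume "\<bar>x * real n - real_of_int i\<bar> < \<delta> \<and> \<bar>x * real n - real_of_int j\<bar> < \<delta>"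
        then have "\<bar>real_of_int i - real_of_int j\<bar> < 1" using \<delta> by linarith
        then show False using ij by linarith
      qed
    qed
    have "\<delta> * totient_ratio n * (\<beta> - \<alpha>) = real n * (\<beta> - \<alpha>) / 2 * \<kappa> * (2 * \<delta> / real n)"
      using npos by (simp add: \<kappa>_def)
    also have "\<dots> \<le> real (card K) * (2 * \<delta> / real n)"
      using cardK \<delta> by (intro mult_right_mono) auto
    also have "\<dots> = (\<Sum>k\<in>K. measure lebesgue (I k))"
    proof -
      have "measure lebesgue (I k) = 2 * \<delta> / real n" for k
        unfolding I_def using \<delta> by (simp add: divide_right_mono) (simp add: diff_divide_distrib add_divide_distrib)
      then show ?thesis by simp
    qed
    also have "\<dots> = measure lebesgue (\<Union>k\<in>K. I k)"
      using fK Ilm disj by (rule measure_UNION'[symmetric])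
    also have "\<dots> \<le> measure lebesgue (approx_set n \<delta> \<inter> {\<alpha>..<\<beta>})"
      using sub Ilm fK approx_set_lmeasurable
      by (intro measure_mono_fmeasurable fmeasurable_Int_fmeasurable) (auto intro!: fmeasurableD sets.finite_UN)
    finally show "\<delta> * totient_ratio n * (\<beta> - \<alpha>) \<le> measure lebesgue (approx_set n \<delta> \<inter> {\<alpha>..<\<beta>})" .
  qed
qed

subsection \<open>The second moment\<close>

lemma mult_powr_minus_Suc:
  fixes x e :: real
  assumes "x > 0"
  shows "x * x powr - (1 + e) = x powr - e"
proof -
  have "x powr - e = x powr (1 + - (1 + e))" by simp
  also have "\<dots> = x powr 1 * x powr - (1 + e)" by (rule powr_add)
  finally show ?thesis using assms by simp
qed

lemma one_le_powr_uminus: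
  fixes x e :: real
  assumes "0 < x" "x \<le> 1" "0 \<le> e"
  shows "1 \<le> x powr - e"
  using assms by (simp add: powr_minus_divide powr_le1)

text \<open>The height condition gives \<open>D \<ge> \<delta> powr - \<theta>\<close>, that is
  \<open>1 / \<delta> \<le> D powr (1 / \<theta>)\<close>. Then
  \<open>max a b = D / \<delta>\<close> is at most \<open>D powr (1 + 1 / \<theta>)\<close>, and the
  sieve applies to \<open>q = a * b\<close> with the exponent \<open>B\<close>.\<close>

lemma overlap_factor_good:
  fixes \<theta> :: real
  assumes "0 < \<theta>" "0 < \<delta>" "\<delta> \<le> 1" "a > 0" "b > 0"
    and big: "\<delta> powr - (1 + \<theta>) < real (max a b)"
  defines "D \<equiv> \<delta> * real (max a b)" and "B \<equiv> nat \<lceil>2 + 2 / \<theta>\<rceil>"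
  shows "(\<Sum>c\<in>{c \<in> {1..nat \<lfloor>2 * D\<rfloor>}. coprime c (a * b)}. 1 / totient_ratio c) / (D * totient_ratio (a * b))
    \<le> 4 * exp (3 + 2 * real B)"
proof -
  define Z where "Z = nat \<lfloor>2 * D\<rfloor>"
  have \<kappa>: "totient_ratio (a * b) > 0" using assms by (intro totient_ratio_pos) simp
  have D1: "\<delta> powr - \<theta> \<le> D"
  proof -
    have "\<delta> powr - \<theta> = \<delta> * \<delta> powr - (1 + \<theta>)"
      using assms(2) by (rule mult_powr_minus_Suc[symmetric])
    also have "\<dots> \<le> D" unfolding D_def using big assms(2) by (intro mult_left_mono) auto
    finally show ?thesis .
  qed
  have "1 \<le> \<delta> powr - \<theta>" using assms by (intro one_le_powr_uminus) auto
  then have D: "D \<ge> 1" using D1 by simp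
  have ZD: "D \<le> real Z" "real Z \<le> 2 * D" using D unfolding Z_def by linarith+
  have Z1: "Z \<ge> 1" using ZD D by linarith
  have "1 / \<delta> \<le> D powr (1 / \<theta>)"
  proof -
    have "(\<delta> powr - \<theta>) powr (1 / \<theta>) = \<delta> powr - 1"
      unfolding powr_powr using assms(1) by simp
    then have "1 / \<delta> = (\<delta> powr - \<theta>) powr (1 / \<theta>)" using assms(2) by (simp add: powr_minus_divide)
    also have "\<dots> \<le> D powr (1 / \<theta>)" using D1 assms by (intro powr_mono2) auto
    finally show ?thesis .
  qed
  then have mab: "real (max a b) \<le> D powr (1 + 1 / \<theta>)"
  proof -
    assume le: "1 / \<delta> \<le> D powr (1 / \<theta>)"
    have "real (max a b) = D * (1 / \<delta>)" using assms(2) by (simp add: D_def)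
    also have "\<dots> \<le> D * D powr (1 / \<theta>)" using le D by (intro mult_left_mono) auto
    also have "\<dots> = D powr (1 + 1 / \<theta>)" using D by (simp add: powr_add)
    finally show ?thesis .
  qed
  have "real (a * b) \<le> real (max a b) * real (max a b)"
    unfolding of_nat_mult by (intro mult_mono) auto
  also have "\<dots> \<le> D powr (1 + 1 / \<theta>) * D powr (1 + 1 / \<theta>)"
    using mab by (intro mult_mono) auto
  also have "\<dots> = D powr (2 + 2 / \<theta>)" by (simp add: powr_add[symmetric])
  also have "\<dots> \<le> D powr real B"
  proof (rule powr_mono)
    show "2 + 2 / \<theta> \<le> real B" unfolding B_def using assms(1) by linarith
  qed (use D in simp)
  also have "\<dots> \<le> real Z powr real B" using ZD D by (intro powr_mono2) auto
  also have "\<dots> = real (Z ^ B)" using Z1 by (simp add: powr_realpow)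
  finally have ab: "a * b \<le> Z ^ B" by (simp only: of_nat_le_iff)
  have B1: "B \<ge> 1"
  proof -
    have "2 / \<theta> > 0" using assms(1) by simp
    then show ?thesis unfolding B_def by linarith
  qed
  have "(\<Sum>c\<in>{c \<in> {1..Z}. coprime c (a * b)}. 1 / totient_ratio c)
    \<le> 2 * exp (3 + 2 * real B) * real Z * totient_ratio (a * b)"
    using Z1 assms ab B1 by (intro sum_coprime_inverse_totient_ratio_le) auto
  also have "\<dots> \<le> 2 * exp (3 + 2 * real B) * (2 * D) * totient_ratio (a * b)"
    using ZD \<kappa> by (intro mult_right_mono mult_left_mono) auto
  also have "\<dots> = 4 * exp (3 + 2 * real B) * (D * totient_ratio (a * b))" by simp
  finally show ?thesis
    using \<kappa> D unfolding Z_def[symmetric] by (subst pos_divide_le_eq) auto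
qed

text \<open>Without a sieve there are at most \<open>2 * D\<close> terms, and the divisor bound is
  used three times over: once for \<open>c \<le> X\<close>, and twice for
  \<open>a * b \<le> X\<^sup>2\<close>.\<close>

lemma overlap_factor_bad:
  fixes \<eta> :: real
  assumes C: "C \<ge> 1" "\<And>n::nat. n > 0 \<Longrightarrow> real (card {d. d dvd n}) \<le> C * real n powr \<eta>"
    and "0 < \<eta>" "0 < \<delta>" "\<delta> \<le> 1 / 2" "a > 0" "b > 0" and X: "max a b \<le> X"
  defines "D \<equiv> \<delta> * real (max a b)"
  shows "(\<Sum>c\<in>{c \<in> {1..nat \<lfloor>2 * D\<rfloor>}. coprime c (a * b)}. 1 / totient_ratio c) / (D * totient_ratio (a * b))
    \<le> 2 * C\<^sup>2 * real X powr (3 * \<eta>)"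
proof -
  define Z where "Z = nat \<lfloor>2 * D\<rfloor>"
  have inv: "1 / totient_ratio n \<le> C * real n powr \<eta>" if "n > 0" for n
    using inverse_totient_ratio_le_card_divisors[OF that] C(2)[OF that] by linarith
  have D0: "D > 0" using assms by (simp add: D_def)
  have ZD: "real Z \<le> 2 * D" using D0 unfolding Z_def by linarith
  have "2 * D \<le> real (max a b)"
  proof -
    have "2 * D = (2 * \<delta>) * real (max a b)" by (simp add: D_def)
    also have "\<dots> \<le> 1 * real (max a b)" using assms by (intro mult_right_mono) auto
    finally show ?thesis by simp
  qed
  then have ZX: "real Z \<le> real X" using ZD X by linarith
  have "(\<Sum>c\<in>{c \<in> {1..Z}. coprime c (a * b)}. 1 / totient_ratio c)
     \<le> (\<Sum>c\<in>{c \<in> {1..Z}. coprime c (a * b)}. C * real X powr \<eta>)"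
  proof (rule sum_mono)
    fix c assume c: "c \<in> {c \<in> {1..Z}. coprime c (a * b)}"
    then have "1 / totient_ratio c \<le> C * real c powr \<eta>" by (intro inv) auto
    also have "\<dots> \<le> C * real X powr \<eta>" using c ZX C(1) assms(3) by (intro mult_left_mono powr_mono2) auto
    finally show "1 / totient_ratio c \<le> C * real X powr \<eta>" .
  qed
  also have "\<dots> = real (card {c \<in> {1..Z}. coprime c (a * b)}) * (C * real X powr \<eta>)" by simp
  also have "\<dots> \<le> (2 * D) * (C * real X powr \<eta>)"
  proof (rule mult_right_mono)
    have "card {c \<in> {1..Z}. coprime c (a * b)} \<le> card {1..Z}" by (rule card_mono) auto
    then show "real (card {c \<in> {1..Z}. coprime c (a * b)}) \<le> 2 * D" using ZD by simp
  qed (use C(1) in simp)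
  finally have num: "(\<Sum>c\<in>{c \<in> {1..Z}. coprime c (a * b)}. 1 / totient_ratio c) \<le> (2 * D) * (C * real X powr \<eta>)" .
  have den: "1 / totient_ratio (a * b) \<le> C * (real X powr (2 * \<eta>))"
  proof -
    have "1 / totient_ratio (a * b) \<le> C * real (a * b) powr \<eta>" using assms by (intro inv) simp
    also have "\<dots> \<le> C * (real X * real X) powr \<eta>"
      unfolding of_nat_mult using X C(1) assms(3) by (intro mult_left_mono powr_mono2 mult_mono) auto
    also have "(real X * real X) powr \<eta> = real X powr (2 * \<eta>)"
      by (simp add: powr_mult powr_add[symmetric])
    finally show ?thesis .
  qed
  have \<kappa>: "totient_ratio (a * b) > 0" using assms by (intro totient_ratio_pos) simp
  have "(\<Sum>c\<in>{c \<in> {1..Z}. coprime c (a * b)}. 1 / totient_ratio c) / (D * totient_ratio (a * b))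
    \<le> (2 * D) * (C * real X powr \<eta>) / (D * totient_ratio (a * b))"
    using num D0 \<kappa> by (intro divide_right_mono) auto
  also have "\<dots> = 2 * (C * real X powr \<eta>) * (1 / totient_ratio (a * b))" using D0 by simp
  also have "\<dots> \<le> 2 * (C * real X powr \<eta>) * (C * (real X powr (2 * \<eta>)))"
    using den C(1) by (intro mult_left_mono) auto
  also have "\<dots> = 2 * C\<^sup>2 * (real X powr \<eta> * real X powr (2 * \<eta>))" by (simp add: power2_eq_square)
  also have "real X powr \<eta> * real X powr (2 * \<eta>) = real X powr (3 * \<eta>)" by (simp add: powr_add[symmetric])
  finally show ?thesis unfolding Z_def .
qed

text \<open>
  Pairs whose ratio has height at least \<open>\<delta> powr - (1 + \<theta>)\<close> are quasi-independent; the others lose a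
  factor \<open>\<delta> powr (- O(\<theta>))\<close>, which is absorbed by the power saving in their number.
\<close>

lemma second_moment_le:
  fixes \<epsilon> :: real
  assumes \<epsilon>: "\<epsilon> > 0"
  obtains C where "C > 0"
    "\<And>\<delta> S. 0 < \<delta> \<Longrightarrow> \<delta> \<le> 1 / 2 \<Longrightarrow> finite S \<Longrightarrow> (\<And>n. n \<in> S \<Longrightarrow> n \<ge> 2) \<Longrightarrow>
      \<delta> powr - (1 + \<epsilon>) \<le> (\<Sum>n\<in>S. totient_ratio n) \<Longrightarrow>
      (\<Sum>m\<in>S. \<Sum>n\<in>S. measure lebesgue (approx_set m \<delta> \<inter> approx_set n \<delta>)) \<le> C * (\<delta> * (\<Sum>n\<in>S. totient_ratio n))\<^sup>2"
proof -
  \<comment> \<open>Chosen for the next inequality: bounding \<open>\<theta>\<^sup>2\<close> by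
    \<theta>, it reduces to \<open>\<theta> * (6 + \<epsilon>) \<le> \<epsilon>\<close>.\<close>
  define \<theta> where "\<theta> = \<epsilon> / (6 + \<epsilon>)"
  have \<theta>: "0 < \<theta>" "\<theta> < 1" using \<epsilon> by (simp_all add: \<theta>_def field_simps)
  have \<theta>\<epsilon>: "(1 + \<theta>) * (1 + 2 * \<theta>) \<le> (1 + \<epsilon>) * (1 - \<theta>)"
  proof -
    have "2 * \<theta> * \<theta> \<le> 2 * \<theta>" using \<theta> by simp
    moreover have "\<theta> * (6 + \<epsilon>) = \<epsilon>" using \<epsilon> by (simp add: \<theta>_def)
    ultimately show ?thesis by (simp add: algebra_simps)
  qed
  obtain C1 where C1: "C1 \<ge> 1" "\<And>n::nat. n > 0 \<Longrightarrow> real (card {d. d dvd n}) \<le> C1 * real n powr (\<theta> / 3)"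
    using card_divisors_le_powr[of "\<theta> / 3"] \<theta> by auto
  obtain C2 where C2: "C2 > 0"
    "\<And>X S v. X \<ge> 1 \<Longrightarrow> finite S \<Longrightarrow> 0 \<notin> S \<Longrightarrow> (\<And>x. x \<in> S \<Longrightarrow> 0 \<le> v x \<and> v x \<le> 1) \<Longrightarrow>
      (\<Sum>x\<in>S. v x) \<ge> 1 \<Longrightarrow>
      (\<Sum>m\<in>S. \<Sum>n\<in>S. if m div gcd m n \<le> X \<and> n div gcd m n \<le> X then v m * v n else 0)
        \<le> C2 * real X powr (1 + \<theta>) * (\<Sum>x\<in>S. v x) powr (1 + \<theta>)"
    using sum_pairs_small_height_le[OF \<theta>(1)] by blast
  define E where "E = 4 * exp (3 + 2 * real (nat \<lceil>2 + 2 / \<theta>\<rceil>))"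
  have E0: "E > 0" by (simp add: E_def)
  \<comment> \<open>The three summands come from the diagonal, the quasi-independent pairs and the
    exceptional pairs.\<close>
  define C where "C = 2 + 4 * E + 8 * C1\<^sup>2 * C2"
  show thesis
  proof (rule that[of C])
    show "C > 0" using E0 C1 C2(1) by (simp add: C_def add_pos_nonneg)
    fix \<delta> :: real and S :: "nat set"
    assume \<delta>: "0 < \<delta>" "\<delta> \<le> 1 / 2" and S: "finite S" and S2: "\<And>n. n \<in> S \<Longrightarrow> n \<ge> 2"
      and big: "\<delta> powr - (1 + \<epsilon>) \<le> (\<Sum>n\<in>S. totient_ratio n)"
    define v where "v = totient_ratio"
    define M where "M = (\<Sum>n\<in>S. v n)"
    have bigM: "\<delta> powr - (1 + \<epsilon>) \<le> M" using big by (simp add: M_def v_def)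
    have S0: "0 \<notin> S" using S2 by fastforce
    have v: "0 < v n" "v n \<le> 1" if "n \<in> S" for n
      using S2[OF that] by (auto simp: v_def totient_ratio_le_1 intro: totient_ratio_pos)
    \<comment> \<open>This lets the linear contribution of the diagonal be absorbed by
      \<open>(\<delta> * M)\<^sup>2\<close>.\<close>
    have \<delta>M: "\<delta> * M \<ge> 1"
    proof -
      have "1 \<le> \<delta> powr - \<epsilon>" using \<delta> \<epsilon> by (intro one_le_powr_uminus) auto
      also have "\<delta> powr - \<epsilon> = \<delta> * \<delta> powr - (1 + \<epsilon>)"
        using \<delta>(1) by (rule mult_powr_minus_Suc[symmetric])
      also have "\<dots> \<le> \<delta> * M" using bigM \<delta> by (intro mult_left_mono) auto
      finally show ?thesis .
    qed
    have M1: "M \<ge> 1"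
    proof -
      have "1 \<le> \<delta> powr - (1 + \<epsilon>)" using \<delta> \<epsilon> by (intro one_le_powr_uminus) auto
      then show ?thesis using bigM by linarith
    qed
    define X where "X = nat \<lfloor>\<delta> powr - (1 + \<theta>)\<rfloor>"
    have "1 \<le> \<delta> powr - (1 + \<theta>)" using \<delta> \<theta> by (intro one_le_powr_uminus) auto
    then have X1: "X \<ge> 1" and X2: "real X \<le> \<delta> powr - (1 + \<theta>)" unfolding X_def by linarith+
    define P where "P = (\<lambda>m n. m div gcd m n \<le> X \<and> n div gcd m n \<le> X)"
    have pair: "measure lebesgue (approx_set m \<delta> \<inter> approx_set n \<delta>)
      \<le> (if m = n then 2 * \<delta> * v m else 0) + 4 * \<delta>\<^sup>2 * E * (v m * v n)
        + 8 * \<delta>\<^sup>2 * C1\<^sup>2 * real X powr \<theta> * (if P m n then v m * v n else 0)" (is "_ \<le> ?a + ?b + ?c")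
      if mn: "m \<in> S" "n \<in> S" for m n
    proof -
      have m2: "m \<ge> 2" and n2: "n \<ge> 2" using S2 mn by auto
      have a0: "?a \<ge> 0" using v(1)[OF mn(2)] \<delta> by simp
      have b0: "?b \<ge> 0" using v(1)[OF mn(1)] v(1)[OF mn(2)] E0 by simp
      have c0: "?c \<ge> 0" using v(1)[OF mn(1)] v(1)[OF mn(2)] by simp
      show ?thesis
      proof (cases "m = n")
        case True
        have "measure lebesgue (approx_set m \<delta> \<inter> approx_set n \<delta>) \<le> ?a"
          using measure_approx_set_le[OF m2 \<delta>] True by (simp add: v_def)
        then show ?thesis using b0 c0 by linarith
      next
        case False
        define a where "a = m div gcd m n"
        define b where "b = n div gcd m n"
        define H where "H = (\<Sum>c\<in>{c \<in> {1..nat \<lfloor>2 * (\<delta> * real (max a b))\<rfloor>}. coprime c (a * b)}. 1 / totient_ratio c)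
          / (\<delta> * real (max a b) * totient_ratio (a * b))"
        have ab0: "a > 0" "b > 0" unfolding a_def b_def
          using m2 n2 by (auto simp: div_greater_zero_iff intro: gcd_le1_nat gcd_le2_nat)
        have le: "measure lebesgue (approx_set m \<delta> \<inter> approx_set n \<delta>) \<le> 4 * \<delta>\<^sup>2 * v m * v n * H"
          using measure_overlap_le[OF m2 n2 False \<delta>] by (simp only: H_def a_def b_def v_def)
        have vv: "0 \<le> 4 * \<delta>\<^sup>2 * v m * v n" using v(1)[OF mn(1)] v(1)[OF mn(2)] by simp
        show ?thesis
        proof (cases "max a b \<le> X")
          case True
          have "H \<le> 2 * C1\<^sup>2 * real X powr (3 * (\<theta> / 3))"
            unfolding H_def using C1 \<theta> \<delta> ab0 True by (intro overlap_factor_bad) auto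
          then have "4 * \<delta>\<^sup>2 * v m * v n * H \<le> 4 * \<delta>\<^sup>2 * v m * v n * (2 * C1\<^sup>2 * real X powr \<theta>)"
            using vv by (intro mult_left_mono) auto
          also have "\<dots> = ?c" using True by (simp add: P_def a_def b_def)
          finally show ?thesis using le a0 b0 by linarith
        next
          case False
          then have "\<delta> powr - (1 + \<theta>) < real (max a b)" unfolding X_def by linarith
          then have "H \<le> E"
            unfolding H_def E_def using \<theta> \<delta> ab0 by (intro overlap_factor_good) auto
          then have "4 * \<delta>\<^sup>2 * v m * v n * H \<le> 4 * \<delta>\<^sup>2 * v m * v n * E"
            using vv by (intro mult_left_mono) auto
          also have "\<dots> = ?b" by simp
          finally show ?thesis using le a0 c0 by linarith
        qed
      qed
    qed
    have "(\<Sum>m\<in>S. \<Sum>n\<in>S. measure lebesgue (approx_set m \<delta> \<inter> approx_set n \<delta>))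
      \<le> (\<Sum>m\<in>S. \<Sum>n\<in>S. (if m = n then 2 * \<delta> * v m else 0) + 4 * \<delta>\<^sup>2 * E * (v m * v n)
        + 8 * \<delta>\<^sup>2 * C1\<^sup>2 * real X powr \<theta> * (if P m n then v m * v n else 0))"
      by (intro sum_mono pair)
    also have "\<dots> = 2 * \<delta> * M + 4 * \<delta>\<^sup>2 * E * (M * M)
        + 8 * \<delta>\<^sup>2 * C1\<^sup>2 * real X powr \<theta> * (\<Sum>m\<in>S. \<Sum>n\<in>S. if P m n then v m * v n else 0)"
    proof -
      have "(\<Sum>m\<in>S. \<Sum>n\<in>S. if m = n then 2 * \<delta> * v m else 0) = 2 * \<delta> * M"
        using S by (simp add: sum.delta M_def sum_distrib_left)
      moreover have "(\<Sum>m\<in>S. \<Sum>n\<in>S. 4 * \<delta>\<^sup>2 * E * (v m * v n)) = 4 * \<delta>\<^sup>2 * E * (M * M)"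
        unfolding M_def sum_product by (simp only: sum_distrib_left)
      ultimately show ?thesis by (simp only: sum.distrib sum_distrib_left)
    qed
    also have "\<dots> \<le> 2 * (\<delta> * M)\<^sup>2 + 4 * E * (\<delta> * M)\<^sup>2 + 8 * C1\<^sup>2 * C2 * (\<delta> * M)\<^sup>2"
    proof (intro add_mono)
      show "2 * \<delta> * M \<le> 2 * (\<delta> * M)\<^sup>2"
        using mult_left_mono[OF \<delta>M, of "\<delta> * M"] \<delta>M by (simp add: power2_eq_square)
      show "4 * \<delta>\<^sup>2 * E * (M * M) \<le> 4 * E * (\<delta> * M)\<^sup>2" by (simp add: power2_eq_square)
      have "real X powr \<theta> * (\<Sum>m\<in>S. \<Sum>n\<in>S. if P m n then v m * v n else 0)
        \<le> real X powr \<theta> * (C2 * real X powr (1 + \<theta>) * M powr (1 + \<theta>))"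
        unfolding P_def M_def using X1 S S0 v M1
        by (intro mult_left_mono C2(2)) (auto simp: M_def less_imp_le)
      also have "\<dots> = C2 * (real X powr (1 + 2 * \<theta>)) * M powr (1 + \<theta>)"
      proof -
        have "real X powr \<theta> * real X powr (1 + \<theta>) = real X powr (\<theta> + (1 + \<theta>))"
          by (rule powr_add[symmetric])
        also have "\<theta> + (1 + \<theta>) = 1 + 2 * \<theta>" by simp
        finally have "real X powr \<theta> * real X powr (1 + \<theta>) = real X powr (1 + 2 * \<theta>)" .
        then show ?thesis by (simp add: mult.left_commute)
      qed
      \<comment> \<open>Here the lower bound on \<open>M\<close> is decisive: all powers of
        \<open>X\<close>, from the number of exceptional pairs and from their correction factor, fit
        into \<open>M powr (1 - \<theta>)\<close>.\<close>
      also have "\<dots> \<le> C2 * (M powr (1 - \<theta>)) * M powr (1 + \<theta>)"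
      proof -
        have "real X powr (1 + 2 * \<theta>) \<le> (\<delta> powr - (1 + \<theta>)) powr (1 + 2 * \<theta>)"
          using X2 \<theta> by (intro powr_mono2) auto
        also have "\<dots> = \<delta> powr - ((1 + \<theta>) * (1 + 2 * \<theta>))" by (simp only: powr_powr mult_minus_left)
        also have "\<dots> \<le> \<delta> powr - ((1 + \<epsilon>) * (1 - \<theta>))"
          using \<theta>\<epsilon> \<delta> by (intro powr_mono') auto
        also have "\<dots> = (\<delta> powr - (1 + \<epsilon>)) powr (1 - \<theta>)" by (simp only: powr_powr mult_minus_left)
        also have "\<dots> \<le> M powr (1 - \<theta>)" using bigM \<theta> by (intro powr_mono2) auto
        finally show ?thesis using C2(1) by (intro mult_right_mono mult_left_mono) auto
      qed
      also have "\<dots> = C2 * M\<^sup>2"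
      proof -
        have "M powr (1 - \<theta>) * M powr (1 + \<theta>) = M powr (real 2)" by (simp add: powr_add[symmetric])
        also have "\<dots> = M\<^sup>2" using M1 by (subst powr_realpow) auto
        finally show ?thesis by (simp only: mult.assoc)
      qed
      finally have "8 * \<delta>\<^sup>2 * C1\<^sup>2 * (real X powr \<theta> * (\<Sum>m\<in>S. \<Sum>n\<in>S. if P m n then v m * v n else 0))
        \<le> 8 * \<delta>\<^sup>2 * C1\<^sup>2 * (C2 * M\<^sup>2)" by (intro mult_left_mono) auto
      then show "8 * \<delta>\<^sup>2 * C1\<^sup>2 * real X powr \<theta> * (\<Sum>m\<in>S. \<Sum>n\<in>S. if P m n then v m * v n else 0)
        \<le> 8 * C1\<^sup>2 * C2 * (\<delta> * M)\<^sup>2" by (simp add: power_mult_distrib mult_ac)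
    qed
    also have "\<dots> = C * (\<delta> * M)\<^sup>2" by (simp add: C_def algebra_simps)
    finally show "(\<Sum>m\<in>S. \<Sum>n\<in>S. measure lebesgue (approx_set m \<delta> \<inter> approx_set n \<delta>))
       \<le> C * (\<delta> * (\<Sum>n\<in>S. totient_ratio n))\<^sup>2" by (simp add: M_def v_def)
  qed
qed

subsection \<open>Choice of the finite sets\<close>

text \<open>Otherwise level \<open>k\<close>, where \<psi> is about \<open>2 powr - k\<close>,
  contributes at most a constant times \<open>2 powr (- k * (1 + 2 * \<epsilon>)) * 2 powr (k * (1 +
  \<epsilon>)) = 2 powr (- k * \<epsilon>)\<close>, and the series converges. The finitely many
  terms below \<open>N0\<close> cannot restore divergence.\<close>

lemma exists_dyadic_level_sum:
  fixes \<psi> :: "nat \<Rightarrow> real"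
  assumes \<psi>: "\<And>n. n \<ge> 1 \<Longrightarrow> 0 \<le> \<psi> n \<and> \<psi> n < 1" and \<epsilon>: "\<epsilon> > 0"
    and inf: "(\<Sum>\<^sub>\<infinity>n\<in>{1::nat..}. ennreal (\<psi> n powr (1 + 2 * \<epsilon>) * totient_ratio n)) = \<infinity>"
    and N0: "N0 \<ge> 1"
  obtains S \<delta> where "finite S" "S \<subseteq> {N0..}" "0 < \<delta>" "\<delta> \<le> 1 / 2" "\<And>n. n \<in> S \<Longrightarrow> \<delta> \<le> \<psi> n"
    "\<delta> powr - (1 + \<epsilon>) \<le> (\<Sum>n\<in>S. totient_ratio n)"
proof (rule ccontr)
  assume "\<not> thesis"
  note no = this and witness = that
  have small: "(\<Sum>n\<in>S. totient_ratio n) \<le> \<delta> powr - (1 + \<epsilon>)"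
    if "finite S" "S \<subseteq> {N0..}" "0 < \<delta>" "\<delta> \<le> 1 / 2" "\<And>n. n \<in> S \<Longrightarrow> \<delta> \<le> \<psi> n" for S \<delta>
  proof (rule ccontr)
    assume "\<not> ?thesis"
    then have "\<delta> powr - (1 + \<epsilon>) \<le> (\<Sum>n\<in>S. totient_ratio n)" by simp
    then show False using no witness[of S \<delta>] that by blast
  qed
  define t where "t = (\<lambda>n. \<psi> n powr (1 + 2 * \<epsilon>) * totient_ratio n)"
  have t0: "t n \<ge> 0" for n by (simp add: t_def totient_ratio_def)
  have t1: "t n \<le> 1" if "n \<ge> 1" for n
    unfolding t_def using \<psi>[OF that] \<epsilon> totient_ratio_le_1[of n]
    by (intro mult_le_one powr_le1) (auto simp: totient_ratio_def)
  define q where "q = 2 powr - \<epsilon>"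
  have q: "0 < q" "q < 1"
  proof -
    have "2 powr - \<epsilon> < 2 powr 0" using \<epsilon> by (intro powr_less_mono) auto
    then show "0 < q" "q < 1" by (simp_all add: q_def)
  qed
  define K where "K = 2 powr (1 + 2 * \<epsilon>) * (1 / (1 - q))"
  have K0: "K \<ge> 0" using q by (simp add: K_def)
  \<comment> \<open>Rounding up makes \<open>2 powr - lev n\<close> a lower bound for \<psi>, and
    \<open>\<psi> n < 1\<close> makes the level at least 1, so that
    \<open>\<delta> \<le> 1 / 2\<close>.\<close>
  define lev where "lev = (\<lambda>n. nat \<lceil>- log 2 (\<psi> n)\<rceil>)"
  have lev: "lev n \<ge> 1" "2 powr - real (lev n) \<le> \<psi> n" "\<psi> n \<le> 2 powr (1 - real (lev n))"
    if "n \<ge> 1" "\<psi> n > 0" for n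
  proof -
    have p: "0 < \<psi> n" "\<psi> n < 1" using \<psi> that by auto
    have "log 2 (\<psi> n) < 0" using p by simp
    then have l: "real (lev n) \<ge> - log 2 (\<psi> n)" "real (lev n) \<le> - log 2 (\<psi> n) + 1" "lev n \<ge> 1"
      unfolding lev_def by linarith+
    show "lev n \<ge> 1" by (rule l)
    have eq: "2 powr log 2 (\<psi> n) = \<psi> n" using p by simp
    have "2 powr - real (lev n) \<le> 2 powr log 2 (\<psi> n)" using l by (intro powr_mono) auto
    then show "2 powr - real (lev n) \<le> \<psi> n" using eq by simp
    have "2 powr log 2 (\<psi> n) \<le> 2 powr (1 - real (lev n))" using l by (intro powr_mono) auto
    then show "\<psi> n \<le> 2 powr (1 - real (lev n))" using eq by simp
  qed
  have bound: "(\<Sum>n\<in>F. t n) \<le> real N0 + K" if F: "finite F" "F \<subseteq> {1..}" for F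
  proof -
    define G where "G = {n \<in> F. N0 \<le> n \<and> \<psi> n > 0}"
    have fG: "finite G" using F by (simp add: G_def)
    have G1: "n \<ge> 1" "\<psi> n > 0" "n \<ge> N0" if "n \<in> G" for n using that F(2) by (auto simp: G_def)
    have "(\<Sum>n\<in>F. t n) = (\<Sum>n\<in>{n \<in> F. n < N0}. t n) + (\<Sum>n\<in>F - {n \<in> F. n < N0}. t n)"
      using F by (subst sum.subset_diff[of "{n \<in> F. n < N0}"]) auto
    also have "(\<Sum>n\<in>F - {n \<in> F. n < N0}. t n) = (\<Sum>n\<in>G. t n)"
    proof (rule sum.mono_neutral_right)
      show "\<forall>n\<in>F - {n \<in> F. n < N0} - G. t n = 0"
      proof
        fix n assume n: "n \<in> F - {n \<in> F. n < N0} - G"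
        \<comment> \<open>Points with \<open>\<psi> n = 0\<close> have no dyadic level; their terms
          vanish because \<open>0 powr _ = 0\<close>.\<close>
        then have "\<psi> n = 0" using \<psi>[of n] F(2) by (force simp: G_def)
        then show "t n = 0" by (simp add: t_def)
      qed
    qed (use F in \<open>auto simp: G_def\<close>)
    also have "(\<Sum>n\<in>{n \<in> F. n < N0}. t n) \<le> real N0"
    proof -
      have "(\<Sum>n\<in>{n \<in> F. n < N0}. t n) \<le> (\<Sum>n\<in>{n \<in> F. n < N0}. 1)"
        using F(2) by (intro sum_mono t1) auto
      also have "\<dots> \<le> real N0" using card_mono[of "{..<N0}" "{n \<in> F. n < N0}"] by auto
      finally show ?thesis .
    qed
    also have "(\<Sum>n\<in>G. t n) \<le> K"
    proof -
      have "(\<Sum>n\<in>G. t n) = (\<Sum>k\<in>lev ` G. \<Sum>n\<in>{n \<in> G. lev n = k}. t n)"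
        using fG by (rule sum.image_gen)
      also have "\<dots> \<le> (\<Sum>k\<in>lev ` G. 2 powr (1 + 2 * \<epsilon>) * q ^ k)"
      proof (rule sum_mono)
        fix k assume "k \<in> lev ` G"
        then have k1: "k \<ge> 1" using lev(1) G1 by auto
        let ?S = "{n \<in> G. lev n = k}"
        have "(\<Sum>n\<in>?S. t n) \<le> (\<Sum>n\<in>?S. (2 powr (1 - real k)) powr (1 + 2 * \<epsilon>) * totient_ratio n)"
          unfolding t_def using lev(3) G1 \<epsilon>
          by (intro sum_mono mult_right_mono powr_mono2) (force simp: totient_ratio_def less_imp_le)+
        also have "\<dots> = (2 powr (1 - real k)) powr (1 + 2 * \<epsilon>) * (\<Sum>n\<in>?S. totient_ratio n)"
          by (simp add: sum_distrib_left)
        also have "\<dots> \<le> (2 powr (1 - real k)) powr (1 + 2 * \<epsilon>) * ((2 powr - real k) powr - (1 + \<epsilon>))"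
        proof (intro mult_left_mono small)
          show "2 powr - real k \<le> 1 / 2"
          proof -
            have "2 powr - real k \<le> 2 powr - 1" using k1 by (intro powr_mono) auto
            then show ?thesis by simp
          qed
        qed (use fG G1 lev(2) in auto)
        also have "\<dots> = 2 powr ((1 - real k) * (1 + 2 * \<epsilon>) + - real k * - (1 + \<epsilon>))"
          unfolding powr_powr by (rule powr_add[symmetric])
        also have "(1 - real k) * (1 + 2 * \<epsilon>) + - real k * - (1 + \<epsilon>) = (1 + 2 * \<epsilon>) + - \<epsilon> * real k"
          by (simp add: algebra_simps)
        also have "2 powr \<dots> = 2 powr (1 + 2 * \<epsilon>) * (2 powr - \<epsilon>) powr real k"
          unfolding powr_powr by (rule powr_add)
        also have "(2 powr - \<epsilon>) powr real k = q ^ k"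
          unfolding q_def[symmetric] using q by (intro powr_realpow)
        finally show "(\<Sum>n\<in>?S. t n) \<le> 2 powr (1 + 2 * \<epsilon>) * q ^ k" .
      qed
      also have "\<dots> = 2 powr (1 + 2 * \<epsilon>) * (\<Sum>k\<in>lev ` G. q ^ k)" by (simp add: sum_distrib_left)
      also have "(\<Sum>k\<in>lev ` G. q ^ k) \<le> (\<Sum>k. q ^ k)"
        using q fG by (intro sum_le_suminf summable_geometric) auto
      also have "(\<Sum>k. q ^ k) = 1 / (1 - q)" using q by (intro suminf_geometric) auto
      finally show ?thesis by (simp add: K_def)
    qed
    finally show ?thesis by simp
  qed
  have "(\<Sum>\<^sub>\<infinity>n\<in>{1::nat..}. ennreal (t n)) \<le> ennreal (real N0 + K)"
  proof (subst nonneg_infsum_complete)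
    show "(SUP F\<in>{F. finite F \<and> F \<subseteq> {1..}}. \<Sum>n\<in>F. ennreal (t n)) \<le> ennreal (real N0 + K)"
      using bound t0 by (intro SUP_least) (auto simp: sum_ennreal intro!: ennreal_leI)
  qed simp
  then show False using inf by (simp add: t_def top_unique)
qed

subsection \<open>From moments to full measure\<close>

text \<open>Cauchy--Schwarz in linear form: with
  \<open>f = (\<Sum>n\<in>S. indicator (A n))\<close>, integrate
  \<open>2 * s * f \<le> 1 + s\<^sup>2 * f\<^sup>2\<close> over the part of \<open>E\<close> where
  \<open>f\<close> can be nonzero. The quadratic term is then extended to the whole space, so one
  second moment serves every \<open>E\<close>.\<close>

lemma sum_measure_Int_le:
  fixes A :: "'b \<Rightarrow> 'a::euclidean_space set" and s :: real
  assumes S: "finite S" and A: "\<And>n. n \<in> S \<Longrightarrow> A n \<in> lmeasurable" and E: "E \<in> lmeasurable"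
  shows "2 * s * (\<Sum>n\<in>S. measure lebesgue (A n \<inter> E))
    \<le> measure lebesgue (E \<inter> (\<Union>n\<in>S. A n)) + s\<^sup>2 * (\<Sum>m\<in>S. \<Sum>n\<in>S. measure lebesgue (A m \<inter> A n))"
proof -
  have AE: "A n \<inter> E \<in> lmeasurable" if "n \<in> S" for n
    using A[OF that] E by (intro fmeasurable_Int_fmeasurable fmeasurableD) auto
  have AA: "A m \<inter> A n \<in> lmeasurable" if "m \<in> S" "n \<in> S" for m n
    using A that by (intro fmeasurable_Int_fmeasurable fmeasurableD) auto
  have EU: "E \<inter> (\<Union>n\<in>S. A n) \<in> lmeasurable"
    using A E S by (intro fmeasurable_Int_fmeasurable sets.finite_UN fmeasurableD) auto
  have ind: "integrable lebesgue (indicator X :: _ \<Rightarrow> real)" "(LINT x|lebesgue. indicator X x) = measure lebesgue X"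
    if "X \<in> lmeasurable" for X :: "'a set"
    using that by (auto simp: fmeasurable_def)
  define l where "l = (\<lambda>x. 2 * s * (\<Sum>n\<in>S. indicator (A n \<inter> E) x :: real))"
  define r where "r = (\<lambda>x. indicator (E \<inter> (\<Union>n\<in>S. A n)) x + s\<^sup>2 * (\<Sum>m\<in>S. \<Sum>n\<in>S. indicator (A m \<inter> A n) x :: real))"
  have il: "integrable lebesgue l" unfolding l_def
    by (intro integrable_mult_right Bochner_Integration.integrable_sum ind AE)
  have ir: "integrable lebesgue r" unfolding r_def
    by (intro Bochner_Integration.integrable_add integrable_mult_right Bochner_Integration.integrable_sum ind AA EU)
  have le: "l x \<le> r x" for x
  proof -
    define f where "f = (\<Sum>n\<in>S. indicator (A n) x :: real)"
    have l: "l x = 2 * s * (f * indicator E x)"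
      by (simp add: l_def f_def indicator_inter_arith sum_distrib_right)
    have r: "r x = indicator (E \<inter> (\<Union>n\<in>S. A n)) x + s\<^sup>2 * (f * f)"
      by (simp add: r_def f_def indicator_inter_arith sum_product)
    show ?thesis
    proof (cases "x \<in> E \<inter> (\<Union>n\<in>S. A n)")
      case True
      have "0 \<le> (1 - s * f)\<^sup>2" by simp
      then show ?thesis using True unfolding l r by (simp add: power2_eq_square algebra_simps)
    next
      case False
      have fE: "f * indicator E x = 0"
      proof (cases "x \<in> E")
        case True
        then have "f = 0" unfolding f_def using False by (intro sum.neutral) auto
        then show ?thesis by simp
      qed simp
      show ?thesis unfolding l r fE using False by simp
    qed
  qed
  have "2 * s * (\<Sum>n\<in>S. measure lebesgue (A n \<inter> E)) = (LINT x|lebesgue. l x)"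
    unfolding l_def using ind AE by (simp add: Bochner_Integration.integral_sum)
  also have "\<dots> \<le> (LINT x|lebesgue. r x)"
    using il ir le by (intro integral_mono)
  also have "\<dots> = measure lebesgue (E \<inter> (\<Union>n\<in>S. A n)) + s\<^sup>2 * (\<Sum>m\<in>S. \<Sum>n\<in>S. measure lebesgue (A m \<inter> A n))"
    unfolding r_def using ind AA EU
    by (subst Bochner_Integration.integral_add) (simp_all add: Bochner_Integration.integral_sum)
  finally show ?thesis .
qed

text \<open>A compact set has positive distance from the complement of an open neighbourhood
  \<open>V\<close>. A mesh below that distance keeps every cell meeting \<open>K\<close> inside
  \<open>V\<close>, and \<open>V - K\<close> is small.\<close>

lemma grid_approximation:
  fixes K :: "real set"
  assumes K: "closed K" "K \<subseteq> {0..1}" and \<tau>: "\<tau> > 0"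
  obtains L :: nat and G where "L > 0" "G \<subseteq> {..<L}" "measure lebesgue K \<le> real (card G) / real L"
    "measure lebesgue ((\<Union>i\<in>G. {real i / real L..<real (i + 1) / real L}) - K) \<le> \<tau>"
proof -
  have cK: "compact K" using K by (metis compact_Icc compact_Int_closed Int_absorb1)
  obtain V where V: "open V" "K \<subseteq> V" "V - K \<in> lmeasurable" "emeasure lebesgue (V - K) < ennreal \<tau>"
    using sets_lebesgue_outer_open[OF _ \<tau>, of K] cK by (auto intro: fmeasurableD lmeasurable_compact)
  have mVK: "measure lebesgue (V - K) \<le> \<tau>"
    using V(3,4) \<tau> by (simp add: emeasure_eq_measure2 ennreal_less_iff less_imp_le)
  have "\<exists>d>0. \<forall>x\<in>K. \<forall>y\<in>- V. d \<le> dist x y"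
    using V(1,2) by (intro separate_compact_closed cK) auto
  then obtain d where d: "d > 0" "\<forall>x\<in>K. \<forall>y\<in>- V. d \<le> dist x y" by blast
  obtain L :: nat where L: "L > 0" "1 / real L < d"
    using nat_approx_posE[OF d(1)] by (metis zero_less_Suc)
  define I where "I = (\<lambda>i. {real i / real L..<real (i + 1) / real L})"
  define G where "G = {i \<in> {..<L}. I i \<inter> K \<noteq> {}}"
  have fG: "finite G" by (simp add: G_def)
  have ILM: "I i \<in> lmeasurable" for i
    by (rule bounded_set_imp_lmeasurable) (auto simp: I_def)
  have meas: "measure lebesgue (I i) = 1 / real L" for i
    using L(1) by (simp add: I_def divide_right_mono) (simp add: add_divide_distrib)
  \<comment> \<open>The half-open cells leave out the right end 1, a null set.\<close>
  have "K - {1} \<subseteq> (\<Union>i\<in>G. I i)"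
  proof
    fix x assume x: "x \<in> K - {1}"
    then have x01: "0 \<le> x" "x < 1" using K(2) by force+
    define i where "i = nat \<lfloor>x * real L\<rfloor>"
    have i: "real i \<le> x * real L" "x * real L < real i + 1"
      unfolding i_def using x01 by (auto simp: of_nat_nat)
    have "x * real L < 1 * real L" using x01 L(1) by (intro mult_strict_right_mono) auto
    then have "i < L" using i(1) by linarith
    moreover have "x \<in> I i" using i L(1) by (auto simp: I_def field_simps)
    ultimately have "i < L" "x \<in> I i" by auto
    then show "x \<in> (\<Union>i\<in>G. I i)" using x by (auto simp: G_def)
  qed
  then have "measure lebesgue (K - {1}) \<le> measure lebesgue (\<Union>i\<in>G. I i)"
    using cK fG ILM by (intro measure_mono_fmeasurable fmeasurable.finite_UN)
      (auto intro!: fmeasurableD[OF fmeasurable_Diff] lmeasurable_compact)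
  moreover have "measure lebesgue (K - {1}) = measure lebesgue K"
    by (rule measure_Diff_null_set) (auto intro: fmeasurableD lmeasurable_compact cK)
  moreover have "measure lebesgue (\<Union>i\<in>G. I i) \<le> (\<Sum>i\<in>G. measure lebesgue (I i))"
    using fG ILM by (intro measure_UNION_le) (auto intro: fmeasurableD)
  ultimately have c: "measure lebesgue K \<le> real (card G) / real L" by (simp add: meas)
  have "(\<Union>i\<in>G. I i) - K \<subseteq> V - K"
  proof -
    have "y \<in> V" if i: "i \<in> G" and y: "y \<in> I i" for i y
    proof (rule ccontr)
      assume "y \<notin> V"
      obtain x where x: "x \<in> I i" "x \<in> K" using i by (auto simp: G_def)
      then have "d \<le> dist x y" using d(2) \<open>y \<notin> V\<close> by simp
      moreover have "dist x y \<le> real (i + 1) / real L - real i / real L"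
        using x y by (simp add: I_def dist_real_def abs_le_iff)
      moreover have "\<dots> = 1 / real L" by (simp add: add_divide_distrib)
      ultimately show False using L(2) by linarith
    qed
    then show ?thesis by auto
  qed
  then have "measure lebesgue ((\<Union>i\<in>G. I i) - K) \<le> measure lebesgue (V - K)"
    using V(3) fG fmeasurableD[OF ILM] fmeasurableD[OF lmeasurable_compact[OF cK]]
    by (intro measure_mono_fmeasurable sets.Diff sets.finite_UN) auto
  then have "measure lebesgue ((\<Union>i\<in>G. I i) - K) \<le> \<tau>" using mVK by linarith
  moreover have "G \<subseteq> {..<L}" by (auto simp: G_def)
  ultimately show thesis using that[of L G] L(1) c unfolding I_def by blast
qed

text \<open>Equidistribution is known only on intervals, hence on the grid set \<open>J\<close>. The
  mass found there might sit on \<open>J - K\<close>, but \<open>sum_measure_Int_le\<close> also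
  bounds from above the mass on a set of small measure, so enough of it remains on
  \<open>K\<close>.\<close>

lemma measure_approx_union_ge:
  fixes \<psi> :: "nat \<Rightarrow> real"
  assumes \<psi>: "\<And>n. n \<ge> 1 \<Longrightarrow> 0 \<le> \<psi> n \<and> \<psi> n < 1" and \<epsilon>: "\<epsilon> > 0"
    and inf: "(\<Sum>\<^sub>\<infinity>n\<in>{1::nat..}. ennreal (\<psi> n powr (1 + 2 * \<epsilon>) * totient_ratio n)) = \<infinity>"
    and K: "closed K" "K \<subseteq> {0..1}" "measure lebesgue K > 0"
  obtains c where "c > 0" "\<And>N. c \<le> measure lebesgue (K \<inter> (\<Union>n\<in>{N..}. approx_set n (\<psi> n)))"
proof -
  define \<kappa> where "\<kappa> = measure lebesgue K"
  have \<kappa>: "\<kappa> > 0" using K by (simp add: \<kappa>_def)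
  have cK: "compact K" using K by (metis compact_Icc compact_Int_closed Int_absorb1)
  obtain C where C: "C > 0"
    "\<And>\<delta> S. 0 < \<delta> \<Longrightarrow> \<delta> \<le> 1 / 2 \<Longrightarrow> finite S \<Longrightarrow> (\<And>n. n \<in> S \<Longrightarrow> n \<ge> 2) \<Longrightarrow>
      \<delta> powr - (1 + \<epsilon>) \<le> (\<Sum>n\<in>S. totient_ratio n) \<Longrightarrow>
      (\<Sum>m\<in>S. \<Sum>n\<in>S. measure lebesgue (approx_set m \<delta> \<inter> approx_set n \<delta>)) \<le> C * (\<delta> * (\<Sum>n\<in>S. totient_ratio n))\<^sup>2"
    using second_moment_le[OF \<epsilon>] by blast
  \<comment> \<open>This is the value of \<open>s\<^sup>2 * (C * \<Psi>\<^sup>2)\<close> for the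
    scale \<open>s\<close> chosen below; it serves both as grid accuracy and as the final lower
    bound.\<close>
  define \<tau> where "\<tau> = \<kappa>\<^sup>2 / (4 * C)"
  have \<tau>: "\<tau> > 0" using \<kappa> C(1) by (simp add: \<tau>_def)
  obtain L :: nat and G where L: "L > 0" and G: "G \<subseteq> {..<L}" and cG: "\<kappa> \<le> real (card G) / real L"
    and JK: "measure lebesgue ((\<Union>i\<in>G. {real i / real L..<real (i + 1) / real L}) - K) \<le> \<tau>"
    using grid_approximation[OF K(1,2) \<tau>] unfolding \<kappa>_def by blast
  define I where "I = (\<lambda>i. {real i / real L..<real (i + 1) / real L})"
  define J where "J = (\<Union>i\<in>G. I i)"
  have fG: "finite G" using G finite_subset by auto
  have ILM: "I i \<in> lmeasurable" for i
    by (rule bounded_set_imp_lmeasurable) (auto simp: I_def)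
  have JLM: "J \<in> lmeasurable" unfolding J_def using fG ILM by (intro fmeasurable.finite_UN) auto
  have KLM: "K \<in> lmeasurable" using cK by (rule lmeasurable_compact)
  have "\<forall>i\<in>{..<L}. \<exists>n0. \<forall>n\<ge>n0. \<forall>\<delta>. 0 < \<delta> \<longrightarrow> \<delta> \<le> 1 / 2 \<longrightarrow>
    \<delta> * totient_ratio n * (1 / real L) \<le> measure lebesgue (approx_set n \<delta> \<inter> I i)"
  proof
    fix i assume i: "i \<in> {..<L}"
    have b: "0 \<le> real i / real L" "real i / real L < real (i + 1) / real L" "real (i + 1) / real L \<le> 1"
      using i L by (auto simp: divide_strict_right_mono)
    have len: "real (i + 1) / real L - real i / real L = 1 / real L" by (simp add: add_divide_distrib)
    obtain n0 where "\<And>n \<delta>. n \<ge> n0 \<Longrightarrow> 0 < \<delta> \<Longrightarrow> \<delta> \<le> 1 / 2 \<Longrightarrow>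
      \<delta> * totient_ratio n * (1 / real L) \<le> measure lebesgue (approx_set n \<delta> \<inter> I i)"
      using measure_approx_set_interval_ge[OF b] unfolding len I_def by blast
    then show "\<exists>n0. \<forall>n\<ge>n0. \<forall>\<delta>. 0 < \<delta> \<longrightarrow> \<delta> \<le> 1 / 2 \<longrightarrow>
      \<delta> * totient_ratio n * (1 / real L) \<le> measure lebesgue (approx_set n \<delta> \<inter> I i)" by blast
  qed
  then obtain h where h: "\<And>i n \<delta>. i < L \<Longrightarrow> n \<ge> h i \<Longrightarrow> 0 < \<delta> \<Longrightarrow> \<delta> \<le> 1 / 2 \<Longrightarrow>
      \<delta> * totient_ratio n * (1 / real L) \<le> measure lebesgue (approx_set n \<delta> \<inter> I i)"
    by (metis lessThan_iff)
  define n1 where "n1 = (\<Sum>i<L. h i)"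
  have hn1: "h i \<le> n1" if "i < L" for i
    unfolding n1_def using that by (intro member_le_sum) auto
  show thesis
  proof (rule that[OF \<tau>])
    fix N
    \<comment> \<open>The equidistribution threshold \<open>n1\<close> depends on \<open>K\<close>
      through the grid, which is harmless as levels exist beyond any bound.\<close>
    define N0 where "N0 = Max {N, 2, n1}"
    have N0: "N \<le> N0" "2 \<le> N0" "n1 \<le> N0" by (auto simp: N0_def)
    obtain S \<delta> where S: "finite S" "S \<subseteq> {N0..}" and \<delta>: "0 < \<delta>" "\<delta> \<le> 1 / 2"
      and \<delta>\<psi>: "\<And>n. n \<in> S \<Longrightarrow> \<delta> \<le> \<psi> n" and big: "\<delta> powr - (1 + \<epsilon>) \<le> (\<Sum>n\<in>S. totient_ratio n)"
      using exists_dyadic_level_sum[OF \<psi> \<epsilon> inf, of N0] N0 by auto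
    define A where "A = (\<lambda>n. approx_set n \<delta>)"
    define M where "M = (\<Sum>n\<in>S. totient_ratio n)"
    define \<Psi> where "\<Psi> = \<delta> * M"
    define Q where "Q = (\<Sum>m\<in>S. \<Sum>n\<in>S. measure lebesgue (A m \<inter> A n))"
    have S2: "n \<ge> 2" "n \<ge> n1" "n \<ge> N" if "n \<in> S" for n using that S(2) N0 by auto
    have "M > 0" using big \<delta> by (metis M_def less_le_trans powr_gt_zero less_irrefl)
    then have \<Psi>: "\<Psi> > 0" using \<delta> by (simp add: \<Psi>_def)
    have Q: "Q \<le> C * \<Psi>\<^sup>2"
      unfolding Q_def \<Psi>_def A_def M_def using \<delta> S(1) S2 big by (intro C(2)) auto
    have ALM: "A n \<in> lmeasurable" for n by (simp add: A_def approx_set_lmeasurable)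
    have sumJ: "\<Psi> * \<kappa> \<le> (\<Sum>n\<in>S. measure lebesgue (A n \<inter> J))"
    proof -
      have "\<Psi> * \<kappa> \<le> \<Psi> * (real (card G) / real L)" using cG \<Psi> by (intro mult_left_mono) auto
      also have "\<dots> = (\<Sum>n\<in>S. \<Sum>i\<in>G. \<delta> * totient_ratio n * (1 / real L))"
        by (simp add: \<Psi>_def M_def sum_distrib_left sum_distrib_right sum_divide_distrib mult_ac)
      also have "\<dots> \<le> (\<Sum>n\<in>S. \<Sum>i\<in>G. measure lebesgue (A n \<inter> I i))"
      proof (intro sum_mono)
        fix n i assume n: "n \<in> S" and i: "i \<in> G"
        have iL: "i < L" using i G by auto
        show "\<delta> * totient_ratio n * (1 / real L) \<le> measure lebesgue (A n \<inter> I i)"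
          unfolding A_def using h[OF iL _ \<delta>] hn1[OF iL] S2[OF n] by simp
      qed
      also have "\<dots> = (\<Sum>n\<in>S. measure lebesgue (\<Union>i\<in>G. A n \<inter> I i))"
      proof (intro sum.cong refl measure_UNION'[symmetric] fG)
        fix n i show "A n \<inter> I i \<in> lmeasurable"
          using ALM ILM by (intro fmeasurable_Int_fmeasurable fmeasurableD)
      next
        fix n
        show "pairwise (\<lambda>i j. disjnt (A n \<inter> I i) (A n \<inter> I j)) G"
        proof (rule pairwiseI)
          fix i j :: nat assume "i \<noteq> j"
          have "False" if "x \<in> I i" "x \<in> I j" for x
          proof -
            have "real i \<le> x * L" "x * L < real i + 1" "real j \<le> x * L" "x * L < real j + 1"
              using that L by (auto simp: I_def field_simps)
            then show False using \<open>i \<noteq> j\<close> by linarith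
          qed
          then show "disjnt (A n \<inter> I i) (A n \<inter> I j)" by (auto simp: disjnt_iff)
        qed
      qed
      also have "\<dots> = (\<Sum>n\<in>S. measure lebesgue (A n \<inter> J))" by (simp only: J_def Int_UN_distrib)
      finally show ?thesis .
    qed
    \<comment> \<open>In units of \<tau>, doubled and scaled by \<open>s\<close>, the mass on
      \<open>J\<close> is at least 4 and that on \<open>J - K\<close> at most \<open>1 + 1\<close>.
      So 2 remain on \<open>K\<close>, of which the second moment takes at most 1.\<close>
    define s where "s = \<kappa> / (2 * C * \<Psi>)"
    have s: "s > 0" using \<kappa> C(1) \<Psi> by (simp add: s_def)
    have sQ: "s\<^sup>2 * Q \<le> \<tau>"
    proof -
      have "s\<^sup>2 * Q \<le> s\<^sup>2 * (C * \<Psi>\<^sup>2)" using Q by (intro mult_left_mono) auto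
      also have "\<dots> = \<tau>" using C(1) \<Psi> by (simp add: s_def \<tau>_def power2_eq_square field_simps)
      finally show ?thesis .
    qed
    have s\<Psi>: "s * (\<Psi> * \<kappa>) = 2 * \<tau>" using C(1) \<Psi> by (simp add: s_def \<tau>_def power2_eq_square field_simps)
    have "2 * s * (\<Sum>n\<in>S. measure lebesgue (A n \<inter> (J - K)))
      \<le> measure lebesgue ((J - K) \<inter> (\<Union>n\<in>S. A n)) + s\<^sup>2 * Q"
      unfolding Q_def using S(1) ALM JLM KLM by (intro sum_measure_Int_le fmeasurable_Diff fmeasurableD) auto
    also have "measure lebesgue ((J - K) \<inter> (\<Union>n\<in>S. A n)) \<le> measure lebesgue (J - K)"
      using JLM KLM ALM S(1)
      by (intro measure_mono_fmeasurable fmeasurable_Diff) (auto intro!: sets.Int sets.Diff sets.finite_UN fmeasurableD)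
    also have "measure lebesgue (J - K) \<le> \<tau>" using JK by (simp add: J_def I_def)
    finally have out: "2 * s * (\<Sum>n\<in>S. measure lebesgue (A n \<inter> (J - K))) \<le> 2 * \<tau>" using sQ by simp
    have "(\<Sum>n\<in>S. measure lebesgue (A n \<inter> J))
      \<le> (\<Sum>n\<in>S. measure lebesgue (A n \<inter> (J - K)) + measure lebesgue (A n \<inter> K))"
    proof (rule sum_mono)
      fix n
      have "measure lebesgue (A n \<inter> J) \<le> measure lebesgue ((A n \<inter> (J - K)) \<union> (A n \<inter> K))"
        using ALM JLM KLM
        by (intro measure_mono_fmeasurable fmeasurable.Un fmeasurable_Int_fmeasurable)
          (auto intro!: sets.Int sets.Diff fmeasurableD)
      also have "\<dots> \<le> measure lebesgue (A n \<inter> (J - K)) + measure lebesgue (A n \<inter> K)"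
        using ALM JLM KLM by (intro measure_Un_le) (auto intro!: sets.Int sets.Diff fmeasurableD)
      finally show "measure lebesgue (A n \<inter> J) \<le> \<dots>" .
    qed
    then have "\<Psi> * \<kappa> \<le> (\<Sum>n\<in>S. measure lebesgue (A n \<inter> (J - K))) + (\<Sum>n\<in>S. measure lebesgue (A n \<inter> K))"
      using sumJ by (simp add: sum.distrib)
    then have "s * (\<Psi> * \<kappa>) \<le> s * ((\<Sum>n\<in>S. measure lebesgue (A n \<inter> (J - K))) + (\<Sum>n\<in>S. measure lebesgue (A n \<inter> K)))"
      using s by (intro mult_left_mono) auto
    then have "2 * s * (\<Sum>n\<in>S. measure lebesgue (A n \<inter> K)) \<ge> 2 * \<tau>"
      using out unfolding s\<Psi> distrib_left by linarith
    moreover have "2 * s * (\<Sum>n\<in>S. measure lebesgue (A n \<inter> K)) \<le> measure lebesgue (K \<inter> (\<Union>n\<in>S. A n)) + s\<^sup>2 * Q"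
      unfolding Q_def using S(1) ALM KLM by (intro sum_measure_Int_le)
    ultimately have "\<tau> \<le> measure lebesgue (K \<inter> (\<Union>n\<in>S. A n))" using sQ by linarith
    also have "\<dots> \<le> measure lebesgue (K \<inter> (\<Union>n\<in>{N..}. approx_set n (\<psi> n)))"
    proof (rule measure_mono_fmeasurable)
      show "K \<inter> (\<Union>n\<in>S. A n) \<subseteq> K \<inter> (\<Union>n\<in>{N..}. approx_set n (\<psi> n))"
        unfolding A_def using approx_set_mono[OF \<delta>\<psi>] S2 by fastforce
      show "K \<inter> (\<Union>n\<in>S. A n) \<in> sets lebesgue"
        using KLM ALM S(1) by (intro sets.Int sets.finite_UN fmeasurableD) auto
      show "K \<inter> (\<Union>n\<in>{N..}. approx_set n (\<psi> n)) \<in> lmeasurable"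
        using KLM approx_set_lmeasurable
        by (intro fmeasurable_Int_fmeasurable sets.countable_UN') (auto intro!: fmeasurableD)
    qed
    finally show "\<tau> \<le> measure lebesgue (K \<inter> (\<Union>n\<in>{N..}. approx_set n (\<psi> n)))" .
  qed
qed

text \<open>For each \<open>n\<close> only finitely many \<open>m\<close> satisfy the inequality, so
  infinitely many pairs means infinitely many \<open>n\<close>. Starting at \<open>Suc N\<close>
  keeps out \<open>n = 0\<close>.\<close>

lemma W_eq_limsup_approx_set: "W \<psi> = (\<Inter>N. \<Union>n\<in>{Suc N..}. approx_set n (\<psi> n))"
proof (intro equalityI subsetI)
  fix x assume x: "x \<in> W \<psi>"
  define R where "R = {(n :: nat, m :: int). n \<ge> 1 \<and> coprime (int n) m \<and> \<bar>x * real n - real_of_int m\<bar> < \<psi> n}"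
  have x01: "x \<in> {0..1}" and inf: "infinite R" using x by (auto simp: W_def R_def)
  have "\<exists>n\<ge>Suc N. x \<in> approx_set n (\<psi> n)" for N
  proof (rule ccontr)
    assume none: "\<not> (\<exists>n\<ge>Suc N. x \<in> approx_set n (\<psi> n))"
    have "R \<subseteq> (\<Union>n\<in>{..N}. {n} \<times> {\<lfloor>x * real n - \<psi> n\<rfloor>..\<lceil>x * real n + \<psi> n\<rceil>})"
    proof
      fix p assume p: "p \<in> R"
      obtain n m where pm: "p = (n, m)" by (cases p)
      have nm: "coprime (int n) m" "\<bar>x * real n - real_of_int m\<bar> < \<psi> n" using p by (auto simp: R_def pm)
      then have "n \<le> N" using none x01 by (force simp: approx_set_def not_less_eq_eq)
      moreover have "\<lfloor>x * real n - \<psi> n\<rfloor> \<le> m" "m \<le> \<lceil>x * real n + \<psi> n\<rceil>" using nm(2) by linarith+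
      ultimately show "p \<in> (\<Union>n\<in>{..N}. {n} \<times> {\<lfloor>x * real n - \<psi> n\<rfloor>..\<lceil>x * real n + \<psi> n\<rceil>})"
        by (auto simp: pm)
    qed
    then have "finite R" by (rule finite_subset) auto
    then show False using inf by simp
  qed
  then show "x \<in> (\<Inter>N. \<Union>n\<in>{Suc N..}. approx_set n (\<psi> n))" by auto
next
  fix x assume x: "x \<in> (\<Inter>N. \<Union>n\<in>{Suc N..}. approx_set n (\<psi> n))"
  define R where "R = {(n :: nat, m :: int). n \<ge> 1 \<and> coprime (int n) m \<and> \<bar>x * real n - real_of_int m\<bar> < \<psi> n}"
  have ex: "\<exists>n\<ge>Suc N. x \<in> approx_set n (\<psi> n)" for N using x by auto
  then have x01: "x \<in> {0..1}" by (auto simp: approx_set_def)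
  have "\<exists>n\<ge>N. n \<in> fst ` R" for N
  proof -
    obtain n where n: "n \<ge> Suc N" "x \<in> approx_set n (\<psi> n)" using ex by blast
    then obtain m where "(n, m) \<in> R" by (auto simp: approx_set_def R_def)
    then have "n \<in> fst ` R" by force
    then show ?thesis using n(1) by (meson Suc_leD)
  qed
  then have "infinite (fst ` R)" by (simp add: infinite_nat_iff_unbounded_le)
  then have "infinite R" by blast
  then show "x \<in> W \<psi>" using x01 by (simp add: W_def R_def)
qed

theorem theorem1p1:
  fixes \<psi> :: "nat \<Rightarrow> real"
  assumes "\<And>n. n \<ge> 1 \<Longrightarrow> 0 \<le> \<psi> n \<and> \<psi> n < 1"
    and "\<exists>\<epsilon>::real. \<epsilon> > 0 \<and>
           (\<Sum>\<^sub>\<infinity>n\<in>{1::nat..}. ennreal (\<psi> n powr (1 + \<epsilon>) * (real (totient n) / real n))) = \<infinity>"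
  shows "emeasure lebesgue (W \<psi>) = 1"
proof -
  obtain \<epsilon> where "\<epsilon> > 0"
    and inf: "(\<Sum>\<^sub>\<infinity>n\<in>{1::nat..}. ennreal (\<psi> n powr (1 + \<epsilon>) * (real (totient n) / real n))) = \<infinity>"
    using assms(2) by blast
  \<comment> \<open>The excess exponent is split: one half makes the dyadic series converge, the
    other is the surplus in the level sums required by the second moment.\<close>
  then have \<epsilon>: "\<epsilon> / 2 > 0"
    and inf': "(\<Sum>\<^sub>\<infinity>n\<in>{1::nat..}. ennreal (\<psi> n powr (1 + 2 * (\<epsilon> / 2)) * totient_ratio n)) = \<infinity>"
    by (simp_all add: totient_ratio_def)
  define U where "U = (\<lambda>N. \<Union>n\<in>{Suc N..}. approx_set n (\<psi> n))"
  have WU: "W \<psi> = (\<Inter>N. U N)" by (simp add: U_def W_eq_limsup_approx_set)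
  have Usets: "U N \<in> sets lebesgue" for N
    unfolding U_def using fmeasurableD[OF approx_set_lmeasurable] by (intro sets.countable_UN') auto
  have Wsets: "W \<psi> \<in> sets lebesgue" unfolding WU using Usets by (intro sets.countable_INT) auto
  have W01: "W \<psi> \<subseteq> {0..1}" by (auto simp: W_def)
  define B where "B = {0..1} - W \<psi>"
  have BLM: "B \<in> lmeasurable" unfolding B_def using Wsets by (intro fmeasurable_Diff) auto
  have "measure lebesgue B = 0"
  proof (rule ccontr)
    assume "measure lebesgue B \<noteq> 0"
    then have B0: "measure lebesgue B > 0" by (simp add: zero_less_measure_iff)
    obtain K where K: "closed K" "K \<subseteq> B" "B - K \<in> lmeasurable" "emeasure lebesgue (B - K) < ennreal (measure lebesgue B)"
      using sets_lebesgue_inner_closed[OF fmeasurableD[OF BLM] B0] by blast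
    have K01: "K \<subseteq> {0..1}" using K(2) by (auto simp: B_def)
    have KLM: "K \<in> lmeasurable"
      using K(1) K01 by (metis lmeasurable_compact compact_Icc compact_Int_closed Int_absorb1)
    have "measure lebesgue (B - K) < measure lebesgue B"
      using K(3,4) by (simp add: emeasure_eq_measure2 ennreal_less_iff)
    moreover have "measure lebesgue (B - K) = measure lebesgue B - measure lebesgue K"
      using BLM KLM K(2) by (intro measurable_measure_Diff) (auto intro: fmeasurableD)
    ultimately have K0: "measure lebesgue K > 0" by simp
    obtain c where c: "c > 0" "\<And>N. c \<le> measure lebesgue (K \<inter> (\<Union>n\<in>{N..}. approx_set n (\<psi> n)))"
      using measure_approx_union_ge[OF assms(1) \<epsilon> inf' K(1) K01 K0] by blast
    have KU: "K \<inter> U N \<in> lmeasurable" for N using KLM Usets by (rule fmeasurable_Int_fmeasurable)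
    \<comment> \<open>The sets decrease to the intersection of \<open>K\<close> with
      \<open>W \<psi>\<close>, which is empty, although their measures stay above
      \<open>c\<close>.\<close>
    have "(\<lambda>N. measure lebesgue (K \<inter> U N)) \<longlonglongrightarrow> measure lebesgue (\<Inter>N. K \<inter> U N)"
    proof (rule Lim_measure_decseq)
      show "range (\<lambda>N. K \<inter> U N) \<subseteq> sets lebesgue" using KU by (auto intro: fmeasurableD)
      show "decseq (\<lambda>N. K \<inter> U N)" 
        unfolding decseq_def U_def by (intro allI impI Int_mono UN_mono order_refl) auto
      show "emeasure lebesgue (K \<inter> U i) \<noteq> \<infinity>" for i using KU[of i] by (auto simp: fmeasurable_def)
    qed
    moreover have "(\<Inter>N. K \<inter> U N) = {}" using K(2) by (auto simp: B_def WU)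
    ultimately have "(\<lambda>N. measure lebesgue (K \<inter> U N)) \<longlonglongrightarrow> 0" by simp
    moreover have "\<exists>N. \<forall>n\<ge>N. c \<le> measure lebesgue (K \<inter> U n)" using c(2) by (auto simp: U_def)
    ultimately have "c \<le> 0" by (rule LIMSEQ_le_const)
    then show False using c(1) by simp
  qed
  then have "emeasure lebesgue B = 0" using BLM by (simp add: emeasure_eq_measure2)
  moreover have "emeasure lebesgue (W \<psi>) + emeasure lebesgue B = emeasure lebesgue (W \<psi> \<union> B)"
    using Wsets BLM by (intro plus_emeasure) (auto simp: B_def intro: fmeasurableD)
  moreover have "W \<psi> \<union> B = {0..1}" using W01 by (auto simp: B_def)
  ultimately show ?thesis by simp
qed

end
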